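(* Let $P_0$ be a probability measure on a measurable space $\mathcal X$, let $T>1$ be an integer, and let $h:\mathcal X^T\to\mathbb R$ be measurable. Write $\mathbf X_T=(X_1,\dots,X_T)$. Assume: (i) there are functions $\Lambda_1,\dots,\Lambda_T:\mathcal X\to\mathbb R$ with $|h(x_1,\dots,x_T)|\le\sum_{t=1}^T\Lambda_t(x_t)$, such that for each $t$, $E_0[e^{\theta\Lambda_t(X)}]<\infty$ for all $\theta$ in a neighborhood of $0$; (ii) the random variable $g(X)$, $X\sim P_0$, is non-constant under $P_0$, where $$g(x)=\sum_{t=1}^T E_0[h(\mathbf X_T)\mid X_t=x].$$ Then, as $\eta\to0^+$, the optimal value of $$\max\ E_f[h(\mathbf X_T)]\quad\text{subject to}\quad D(P_f\|P_0)\le\eta,\ \ X_t\overset{i.i.d.}{\sim}P_f\ (t=1,\dots,T),\ \ P_f\in\mathcal P_0$$ satisfies $$\max E_f[h(\mathbf X_T)]=E_0[h(\mathbf X_T)]+\sqrt{2\,Var_0(g(X))}\,\eta^{1/2}+\frac{1}{Var_0(g(X))}\Big(\frac13\kappa_3(g(X))+\nu\Big)\eta+O(\eta^{3/2}),$$ where $Var_0(g(X))$ and $\kappa_3(g(X))=E_0[(g(X)-E_0[g(X)])^3]$ are the variance and third-order cumulant of $g(X)$ under $P_0$, $$\nu=E_0\big[(G(X,Y)-E_0[G(X,Y)])\,(g(X)-E_0[g(X)])\,(g(Y)-E_0[g(Y)])\big],$$ $X,Y$ are independent random variables each with distribution $P_0$, and $$G(x,y)=\sum_{t=1}^T\ \sum_{s=1,\dots,T,\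 s\ne t}E_0[h(\mathbf X_T)\mid X_t=x,X_s=y].$$
   Context: $E_0$ denotes expectation when $X_1,\dots,X_T$ (and generic copies $X,Y$) are i.i.d. with distribution $P_0$; $E_f$ denotes expectation when $X_1,\dots,X_T$ are i.i.d. with distribution $P_f$. $\mathcal P_0$ is the set of all probability measures on $\mathcal X$ absolutely continuous with respect to $P_0$. $D(P_f\|P_0)=E_0\big[\frac{dP_f}{dP_0}\log\frac{dP_f}{dP_0}\big]$ is the Kullback-Leibler divergence. *)

theory Defs
  imports "HOL-Probability.Probability" "HOL-Library.Landau_Symbols"
begin

text \<open>Joint law of \<open>T\<close> i.i.d. draws from \<open>P\<close>, on functions on \<open>{1..T}\<close>
  (extensional outside \<open>{1..T}\<close>).\<close>

abbreviation iid :: "nat \<Rightarrow> 'a measure \<Rightarrow> (nat \<Rightarrow> 'a) measure" where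
  "iid T P \<equiv> PiM {1..T} (\<lambda>_. P)"

text \<open>\<open>\<phi>(z)\<close> is a version of \<open>E\<^bsub>M\<^esub>[f | Z = z]\<close>, where \<open>Z\<close> takes values in the measurable
  space of \<open>N\<close>: \<open>\<phi>\<close> is measurable and \<open>\<phi>(Z)\<close> is a.s. the conditional expectation
  of \<open>f\<close> given the sigma-algebra generated by \<open>Z\<close>. Only the sigma-algebra of \<open>N\<close> matters.\<close>

definition is_cond_exp_given ::
  "'b measure \<Rightarrow> ('b \<Rightarrow> 'c) \<Rightarrow> 'c measure \<Rightarrow> ('b \<Rightarrow> real) \<Rightarrow> ('c \<Rightarrow> real) \<Rightarrow> bool" where
  "is_cond_exp_given M Z N f \<phi> \<longleftrightarrow>
     \<phi> \<in> borel_measurable N \<and>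
     (AE \<omega> in M. \<phi> (Z \<omega>) = real_cond_exp M (vimage_algebra (space M) Z N) f \<omega>)"

definition ac_probs :: "'a measure \<Rightarrow> 'a measure set" where
  "ac_probs P0 = {Pf. prob_space Pf \<and> sets Pf = sets P0 \<and> absolutely_continuous P0 Pf}"

text \<open>\<open>D(Pf || P0) = E\<^sub>0[L log L]\<close> with \<open>L = dPf/dP0\<close>, for \<open>Pf \<in> ac_probs P0\<close>. As \<open>L log L\<close> is
  bounded below, it fails to be integrable only if its integral is \<open>\<infinity>\<close>; the library constant
  \<open>KL_divergence\<close> would be \<open>0\<close> in that case, hence the explicit case distinction.\<close>

definition kl_div :: "'a measure \<Rightarrow> 'a measure \<Rightarrow> ereal" where
  "kl_div Pf P0 =
     (let L = (\<lambda>x. enn2real (RN_deriv P0 Pf x)) in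
      if integrable P0 (\<lambda>x. L x * ln (L x))
      then ereal (\<integral>x. L x * ln (L x) \<partial>P0) else \<infinity>)"

lemma kl_div_eq_KL_divergence:
  assumes P0: "prob_space P0" and Pf: "Pf \<in> ac_probs P0"
    and fin: "kl_div Pf P0 \<noteq> \<infinity>"
  shows "kl_div Pf P0 = ereal (KL_divergence (exp 1) P0 Pf)"
proof -
  interpret P0: prob_space P0 by fact
  interpret Pf: prob_space Pf using Pf by (simp add: ac_probs_def)
  have ac: "absolutely_continuous P0 Pf" "sets Pf = sets P0"
    using Pf by (auto simp: ac_probs_def)
  obtain D where D: "D \<in> borel_measurable P0"
      "AE x in P0. RN_deriv P0 Pf x = ennreal (D x)" "\<And>x. 0 \<le> D x"
    using P0.real_RN_deriv[OF Pf.finite_measure_axioms ac] by metis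
  have dens: "Pf = density P0 (\<lambda>x. ennreal (D x))"
  proof -
    have "Pf = density P0 (RN_deriv P0 Pf)"
      by (rule P0.density_RN_deriv[symmetric, OF ac])
    also have "\<dots> = density P0 (\<lambda>x. ennreal (D x))"
      using D by (intro density_cong) auto
    finally show ?thesis .
  qed
  have "KL_divergence (exp 1) P0 Pf = (\<integral>x. D x * log (exp 1) (D x) \<partial>P0)"
    unfolding dens by (rule P0.KL_density) (use D in auto)
  also have "\<dots> = (\<integral>x. D x * ln (D x) \<partial>P0)"
    by (simp add: log_def)
  also have "\<dots> = (\<integral>x. enn2real (RN_deriv P0 Pf x) * ln (enn2real (RN_deriv P0 Pf x)) \<partial>P0)"
    using D by (intro integral_cong_AE) auto
  finally show ?thesis
    using fin by (simp add: kl_div_def Let_def split: if_splits)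
qed

text \<open>Optimal value of maximizing \<open>E\<^sub>f[h(X\<^sub>1,\<dots>,X\<^sub>T)]\<close> over the Kullback-Leibler ball of
  radius \<open>\<eta>\<close>. It is taken in \<open>ereal\<close> so that unboundedness would be visible.\<close>

definition opt_value :: "'a measure \<Rightarrow> nat \<Rightarrow> ((nat \<Rightarrow> 'a) \<Rightarrow> real) \<Rightarrow> real \<Rightarrow> ereal" where
  "opt_value P0 T h \<eta> =
     (SUP Pf \<in> {Pf \<in> ac_probs P0. kl_div Pf P0 \<le> ereal \<eta>}. ereal (\<integral>x. h x \<partial>iid T Pf))"

definition cumulant3 :: "'a measure \<Rightarrow> ('a \<Rightarrow> real) \<Rightarrow> real" where
  "cumulant3 P X = (\<integral>x. (X x - (\<integral>y. X y \<partial>P)) ^ 3 \<partial>P)"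

definition nu :: "'a measure \<Rightarrow> ('a \<Rightarrow> real) \<Rightarrow> ('a \<times> 'a \<Rightarrow> real) \<Rightarrow> real" where
  "nu P g G =
     (\<integral>z. (G z - (\<integral>w. G w \<partial>(P \<Otimes>\<^sub>M P)))
            * (g (fst z) - (\<integral>x. g x \<partial>P)) * (g (snd z) - (\<integral>x. g x \<partial>P)) \<partial>(P \<Otimes>\<^sub>M P))"

end

theory Submission
  imports Defs
begin

text \<open>
  The extremal laws are, up to a negligible error, the exponential tilts of \<open>P0\<close> along \<open>g\<close>. Let
  \<open>tilt b\<close> be the density proportional to \<open>exp (b * g)\<close>, and \<open>ent b\<close> its relative entropy with
  respect to \<open>P0\<close>. By continuity every small radius \<open>\<eta>\<close> is \<open>ent b\<close> for some small \<open>b\<close>, of order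
  \<open>\<eta> powr (1/2)\<close> (lemma \<open>eventually_ent\<close>). The tilted law is feasible for this radius, so the
  optimal value is at least its expectation of \<open>h\<close>. Conversely, no feasible law does better by more
  than a multiple of \<open>b ^ 3\<close> (lemma \<open>payoff_le_payoff_tilt\<close>). It remains to expand the expectation
  of \<open>h\<close> under the tilted law and \<open>ent b\<close> in powers of \<open>b\<close>, and to eliminate \<open>b\<close> (lemma
  \<open>payoff_tilt_in_terms_of_ent\<close>).

  For the upper bound, let \<open>L\<close> be the density of a competitor of entropy at most \<open>ent b\<close>, and \<open>d\<close> the entropy of \<open>L\<close> relative to the tilted law.
  As \<open>ln (tilt b)\<close> is affine in \<open>g\<close>, the Donsker--Varadhan identity (lemma
  \<open>relative_entropy_tilt\<close>) gives
  \<open>(\<integral>x. g x * (L x - tilt b x) \<partial>P0) \<le> - d / b\<close>: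
  to first order in \<open>L - tilt b\<close> the competitor loses \<open>d / b\<close>. Expanding the product of the \<open>T\<close>
  densities, all other terms are bounded by \<open>N * (N + b)\<close> up to a constant, where \<open>N\<close> is an
  \<open>L\<^sup>1\<close> distance of \<open>L\<close> and \<open>tilt b\<close> with a weight that dominates \<open>h\<close> and \<open>g\<close> (lemma
  \<open>payoff_second_order\<close>). Finite exponential moments of the weight yield a weighted Pinsker
  inequality (lemma \<open>weighted_pinsker\<close>), so \<open>N\<close> is of order \<open>sqrt d\<close>. Finally
  \<open>- d / b + C * (d + b * sqrt d)\<close> is at most of order \<open>b ^ 3\<close>.

  This is carried out for centred \<open>h\<close> and an abstract gradient \<open>g\<close> in the locale
  \<open>dominated_functional\<close>. The conditional expectations enter in the end only, through integrals of
  \<open>h\<close> against functions of one or two coordinates: one coordinate identifies \<open>g\<close> as the gradient, and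
  in the second-order coefficient \<open>E [h * (\<Sum>t. g (X t))\<^sup>2]\<close>, for centred \<open>h\<close> and \<open>g\<close>, the diagonal terms
  add up to the third cumulant and the off-diagonal terms to \<open>nu\<close>.
\<close>

section \<open>Elementary inequalities\<close>

lemma exp_taylor_abs:
  fixes x :: real
  shows "\<bar>exp x - (\<Sum>k<n. x ^ k / fact k)\<bar> \<le> \<bar>x\<bar> ^ n * exp \<bar>x\<bar> / fact n"
proof -
  obtain t where t: "\<bar>t\<bar> \<le> \<bar>x\<bar>" "exp x = (\<Sum>m<n. x ^ m / fact m) + exp t / fact n * x ^ n"
    using Maclaurin_exp_le[of x n] by blast
  have "\<bar>exp x - (\<Sum>k<n. x ^ k / fact k)\<bar> = \<bar>x\<bar> ^ n * exp t / fact n"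
    using t(2) by (simp add: abs_mult power_abs mult.commute)
  also have "\<dots> \<le> \<bar>x\<bar> ^ n * exp \<bar>x\<bar> / fact n"
    using t(1) by (intro divide_right_mono mult_left_mono) auto
  finally show ?thesis .
qed

lemma power_le_exp:
  fixes x c :: real
  assumes "0 \<le> x" "0 < c"
  shows "x ^ k \<le> fact k / c ^ k * exp (c * x)"
proof -
  have "(c * x) ^ k / fact k \<le> (\<Sum>i<Suc k. (c * x) ^ i / fact i)"
    using assms by (intro member_le_sum[where f="\<lambda>i. (c * x) ^ i / fact i"]) auto
  also have "\<dots> \<le> exp (c * x)"
  proof -
    obtain t where "exp (c*x) = (\<Sum>m<Suc k. (c*x) ^ m / fact m) + exp t / fact (Suc k) * (c*x) ^ Suc k"
      using Maclaurin_exp_le[of "c*x" "Suc k"] by blast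
    moreover have "0 \<le> exp t / fact (Suc k) * (c*x) ^ Suc k" using assms by simp
    ultimately show ?thesis by linarith
  qed
  finally show ?thesis using assms by (simp add: field_simps power_mult_distrib)
qed

text \<open>The Legendre--Fenchel inequality for \<open>r \<mapsto> r ln r - r + 1\<close>, whose conjugate is
  \<open>u \<mapsto> exp u - 1\<close>, used at \<open>u = s\<close> and at \<open>u = -s\<close>; the linear terms cancel, and only a
  quadratic term in \<open>s\<close> is left. It turns relative entropy into control of
  \<open>\<bar>L - b\<bar>\<close> with an arbitrary weight \<open>s\<close>.\<close>

lemma entropy_young:
  fixes b L s :: real
  assumes b: "0 < b" and L: "0 \<le> L" and s: "0 \<le> s"
  shows "s * \<bar>L - b\<bar> \<le> (L * ln L - L * ln b - L + b) + b * (s\<^sup>2 * exp s / 2)"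
proof -
  have young: "u * L \<le> L * ln L - L * ln b - L + b * exp u" for u
  proof (cases "L = 0")
    case False
    with L have L: "0 < L" by simp
    have "b * exp u = L * exp (u + ln b - ln L)"
      using L b by (simp add: exp_add exp_diff)
    also have "\<dots> \<ge> L * (1 + (u + ln b - ln L))"
      using L by (intro mult_left_mono exp_ge_add_one_self) auto
    finally show ?thesis by (simp add: algebra_simps)
  qed (use b in auto)
  have t: "exp u - 1 - u \<le> s\<^sup>2 * exp s / 2" if "\<bar>u\<bar> = s" for u
    using exp_taylor_abs[of u 2] that by (simp add: eval_nat_numeral)
  show ?thesis
  proof (cases "L \<ge> b")
    case True
    then show ?thesis
      using young[of s] mult_left_mono[OF t[of s], of b] b s by (simp add: algebra_simps)
  next
    case False
    then show ?thesis
      using young[of "-s"] mult_left_mono[OF t[of "-s"], of b] b s by (simp add: algebra_simps)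
  qed
qed

text \<open>As polynomials in the \<open>\<delta>\<^sub>i\<close> and \<open>\<epsilon>\<^sub>i\<close>, the left-hand sides of the next two lemmas have
  coefficients \<open>0\<close> and \<open>1\<close>, so replacing all variables by their absolute values bounds
  them. The right-hand sides then integrate to closed forms against product measures.\<close>

lemma prod_diff_abs_le:
  fixes d e :: "'i \<Rightarrow> real"
  assumes "finite I"
  shows "\<bar>(\<Prod>i\<in>I. 1 + d i + e i) - (\<Prod>i\<in>I. 1 + d i)\<bar>
    \<le> (\<Prod>i\<in>I. 1 + \<bar>d i\<bar> + \<bar>e i\<bar>) - (\<Prod>i\<in>I. 1 + \<bar>d i\<bar>)"
  using assms
proof (induction I)
  case (insert j I)
  define A where "A = (\<Prod>i\<in>I. 1 + d i + e i)"
  define B where "B = (\<Prod>i\<in>I. 1 + d i)"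
  define A' where "A' = (\<Prod>i\<in>I. 1 + \<bar>d i\<bar> + \<bar>e i\<bar>)"
  define B' where "B' = (\<Prod>i\<in>I. 1 + \<bar>d i\<bar>)"
  have IH: "\<bar>A - B\<bar> \<le> A' - B'" using insert.IH by (simp add: A_def B_def A'_def B'_def)
  have A: "\<bar>A\<bar> \<le> A'"
    unfolding A_def A'_def abs_prod by (intro prod_mono) (auto intro: abs_leI)
  have "(1 + d j + e j) * A - (1 + d j) * B = (A - B) + d j * (A - B) + e j * A"
    by (simp add: algebra_simps)
  also have "\<bar>\<dots>\<bar> \<le> \<bar>A - B\<bar> + \<bar>d j\<bar> * \<bar>A - B\<bar> + \<bar>e j\<bar> * \<bar>A\<bar>"
    unfolding abs_mult[symmetric] by linarith
  also have "\<dots> \<le> (A' - B') + \<bar>d j\<bar> * (A' - B') + \<bar>e j\<bar> * A'"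
    using IH A by (intro add_mono mult_left_mono) auto
  also have "\<dots> = (1 + \<bar>d j\<bar> + \<bar>e j\<bar>) * A' - (1 + \<bar>d j\<bar>) * B'"
    by (simp add: algebra_simps)
  finally show ?case using insert.hyps by (simp add: A_def B_def A'_def B'_def)
qed simp

lemma prod_second_order_abs_le:
  fixes d e :: "'i \<Rightarrow> real"
  assumes "finite I"
  shows "\<bar>(\<Prod>i\<in>I. 1 + d i + e i) - (\<Prod>i\<in>I. 1 + d i) - (\<Sum>i\<in>I. e i)\<bar>
    \<le> (\<Prod>i\<in>I. 1 + \<bar>d i\<bar> + \<bar>e i\<bar>) - (\<Prod>i\<in>I. 1 + \<bar>d i\<bar>) - (\<Sum>i\<in>I. \<bar>e i\<bar>)"
  using assms
proof (induction I)
  case (insert j I)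
  define A where "A = (\<Prod>i\<in>I. 1 + d i + e i)"
  define B where "B = (\<Prod>i\<in>I. 1 + d i)"
  define C where "C = (\<Sum>i\<in>I. e i)"
  define A' where "A' = (\<Prod>i\<in>I. 1 + \<bar>d i\<bar> + \<bar>e i\<bar>)"
  define B' where "B' = (\<Prod>i\<in>I. 1 + \<bar>d i\<bar>)"
  define C' where "C' = (\<Sum>i\<in>I. \<bar>e i\<bar>)"
  have IH: "\<bar>A - B - C\<bar> \<le> A' - B' - C'"
    using insert.IH by (simp add: A_def B_def A'_def B'_def C_def C'_def)
  have AB: "\<bar>A - B\<bar> \<le> A' - B'"
    using prod_diff_abs_le[OF insert.hyps(1), of d e] by (simp add: A_def B_def A'_def B'_def)
  have A1: "\<bar>A - 1\<bar> \<le> A' - 1"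
    using prod_diff_abs_le[OF insert.hyps(1), of "\<lambda>_. 0" "\<lambda>i. d i + e i"]
      prod_mono[of I "\<lambda>i. 1 + \<bar>d i + e i\<bar>" "\<lambda>i. 1 + \<bar>d i\<bar> + \<bar>e i\<bar>"]
    by (simp add: A_def A'_def add.assoc abs_triangle_ineq)
  have "(1 + d j + e j) * A - (1 + d j) * B - (e j + C) = (A - B - C) + d j * (A - B) + e j * (A - 1)"
    by (simp add: algebra_simps)
  also have "\<bar>\<dots>\<bar> \<le> \<bar>A - B - C\<bar> + \<bar>d j\<bar> * \<bar>A - B\<bar> + \<bar>e j\<bar> * \<bar>A - 1\<bar>"
    unfolding abs_mult[symmetric] by linarith
  also have "\<dots> \<le> (A' - B' - C') + \<bar>d j\<bar> * (A' - B') + \<bar>e j\<bar> * (A' - 1)"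
    using IH AB A1 by (intro add_mono mult_left_mono) auto
  also have "\<dots> = (1 + \<bar>d j\<bar> + \<bar>e j\<bar>) * A' - (1 + \<bar>d j\<bar>) * B' - (\<bar>e j\<bar> + C')"
    by (simp add: algebra_simps)
  finally show ?case using insert.hyps by (simp add: A_def B_def A'_def B'_def C_def C'_def)
qed simp

lemma prod_one_plus_ge:
  fixes a :: "'i \<Rightarrow> real"
  assumes "finite I" "\<And>i. i \<in> I \<Longrightarrow> 0 \<le> a i"
  shows "1 + (\<Sum>i\<in>I. a i) \<le> (\<Prod>i\<in>I. 1 + a i)"
proof -
  have "(\<Prod>i\<in>I. 1 + \<bar>a i\<bar>) = (\<Prod>i\<in>I. 1 + a i)" "(\<Sum>i\<in>I. \<bar>a i\<bar>) = (\<Sum>i\<in>I. a i)"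
    using assms(2) by (auto intro!: prod.cong sum.cong)
  thus ?thesis using prod_second_order_abs_le[OF assms(1), of "\<lambda>_. 0" a] by simp
qed

lemma power_diff_le:
  fixes x y :: real
  assumes "0 \<le> x" "x \<le> y"
  shows "y ^ n - x ^ n \<le> n * y ^ (n - 1) * (y - x)"
proof (induction n)
  case (Suc n)
  have "y ^ Suc n - x ^ Suc n = y * (y ^ n - x ^ n) + x ^ n * (y - x)"
    by (simp add: algebra_simps)
  also have "\<dots> \<le> y * (n * y ^ (n - 1) * (y - x)) + y ^ n * (y - x)"
    using Suc assms by (intro add_mono mult_left_mono mult_right_mono power_mono) auto
  also have "y * (n * y ^ (n - 1) * (y - x)) = n * y ^ n * (y - x)"
    by (cases n) auto
  finally show ?case by (simp add: algebra_simps)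
qed simp

lemma power_second_diff_le:
  fixes B D N :: real
  assumes "0 \<le> B" "0 \<le> D" "0 \<le> N"
  shows "(B + D + N) ^ n - (B + D) ^ n - n * N * B ^ (n - 1)
    \<le> n * n * (B + D + N) ^ (n - 2) * (N * (D + N))"
proof -
  let ?y = "B + D + N"
  have "?y ^ n - (B + D) ^ n \<le> n * ?y ^ (n - 1) * N"
    using power_diff_le[of "B + D" ?y n] assms by simp
  moreover have "?y ^ (n - 1) - B ^ (n - 1) \<le> (n - 1 :: nat) * ?y ^ (n - 1 - 1) * (D + N)"
    using power_diff_le[of B ?y "n - 1"] assms by (simp add: add.assoc)
  hence "n * N * (?y ^ (n - 1) - B ^ (n - 1)) \<le> n * N * ((n - 1 :: nat) * ?y ^ (n - 2) * (D + N))"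
    using assms by (intro mult_left_mono) (auto simp: numeral_2_eq_2)
  moreover have "n * N * ((n - 1 :: nat) * ?y ^ (n - 2) * (D + N)) \<le> n * N * (n * ?y ^ (n - 2) * (D + N))"
    using assms by (intro mult_left_mono mult_right_mono) auto
  ultimately show ?thesis by (simp add: algebra_simps)
qed

section \<open>Exponential moments, relative entropy and product densities\<close>

text \<open>All the expansions in the tilting parameter are instances of this one: for the normalising
  constant and its derivative it is used on \<open>P\<close>, and for the tilted expectation of \<open>h\<close> on the
  product measure.\<close>

lemma exp_moment_taylor:
  fixes f S :: "'b \<Rightarrow> real"
  assumes f[measurable]: "f \<in> borel_measurable M" and S[measurable]: "S \<in> borel_measurable M"
    and rem: "integrable M (\<lambda>x. \<bar>f x\<bar> * \<bar>S x\<bar> ^ n * exp (c * \<bar>S x\<bar>))"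
    and mom: "\<And>k. k < n \<Longrightarrow> integrable M (\<lambda>x. f x * S x ^ k)"
    and b: "0 \<le> b" "b \<le> c"
  shows "integrable M (\<lambda>x. f x * exp (b * S x))"
    and "\<bar>(\<integral>x. f x * exp (b * S x) \<partial>M) - (\<Sum>k<n. b ^ k / fact k * (\<integral>x. f x * S x ^ k \<partial>M))\<bar>
      \<le> b ^ n * (\<integral>x. \<bar>f x\<bar> * \<bar>S x\<bar> ^ n * exp (c * \<bar>S x\<bar>) \<partial>M)"
proof -
  define r where "r = (\<lambda>x. f x * (exp (b * S x) - (\<Sum>k<n. (b * S x) ^ k / fact k)))"
  have r[measurable]: "r \<in> borel_measurable M" unfolding r_def by measurable
  have r_le: "\<bar>r x\<bar> \<le> b ^ n * (\<bar>f x\<bar> * \<bar>S x\<bar> ^ n * exp (c * \<bar>S x\<bar>))" for x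
  proof -
    have "\<bar>r x\<bar> \<le> \<bar>f x\<bar> * (\<bar>b * S x\<bar> ^ n * exp \<bar>b * S x\<bar> / fact n)"
      using mult_left_mono[OF exp_taylor_abs[of "b * S x" n], of "\<bar>f x\<bar>"]
      by (simp add: r_def abs_mult)
    also have "\<dots> \<le> \<bar>f x\<bar> * (\<bar>b * S x\<bar> ^ n * exp (c * \<bar>S x\<bar>) / 1)"
      using b by (intro mult_left_mono frac_le) (auto simp: abs_mult fact_ge_1 intro!: mult_right_mono)
    also have "\<dots> = b ^ n * (\<bar>f x\<bar> * \<bar>S x\<bar> ^ n * exp (c * \<bar>S x\<bar>))"
      using b by (simp add: abs_mult power_mult_distrib)
    finally show ?thesis .
  qed
  have int_r: "integrable M r"
    by (rule Bochner_Integration.integrable_bound[OF integrable_mult_right[OF rem, of "b ^ n"]])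
       (use r_le b in \<open>auto simp: abs_mult power_abs\<close>)
  have int_k: "integrable M (\<lambda>x. b ^ k / fact k * (f x * S x ^ k))" if "k < n" for k
    using mom[OF that] by simp
  have split: "f x * exp (b * S x) = r x + (\<Sum>k<n. b ^ k / fact k * (f x * S x ^ k))" for x
    unfolding r_def
    by (simp add: algebra_simps sum_distrib_left sum_distrib_right power_mult_distrib)
  show "integrable M (\<lambda>x. f x * exp (b * S x))"
    unfolding split using int_r int_k by (intro Bochner_Integration.integrable_add
      Bochner_Integration.integrable_sum) auto
  have "(\<integral>x. f x * exp (b * S x) \<partial>M)
      = (\<integral>x. r x \<partial>M) + (\<Sum>k<n. b ^ k / fact k * (\<integral>x. f x * S x ^ k \<partial>M))"
    unfolding split using int_r int_k
    by (subst Bochner_Integration.integral_add) (auto intro!: sum.cong simp: mom)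
  moreover have "\<bar>\<integral>x. r x \<partial>M\<bar> \<le> (\<integral>x. b ^ n * (\<bar>f x\<bar> * \<bar>S x\<bar> ^ n * exp (c * \<bar>S x\<bar>)) \<partial>M)"
    using r_le int_r rem by (intro integral_abs_bound[THEN order_trans] integral_mono) auto
  ultimately show "\<bar>(\<integral>x. f x * exp (b * S x) \<partial>M) - (\<Sum>k<n. b ^ k / fact k * (\<integral>x. f x * S x ^ k \<partial>M))\<bar>
      \<le> b ^ n * (\<integral>x. \<bar>f x\<bar> * \<bar>S x\<bar> ^ n * exp (c * \<bar>S x\<bar>) \<partial>M)"
    by simp
qed

lemma continuous_on_exp_moment:
  fixes f S :: "'b \<Rightarrow> real"
  assumes f[measurable]: "f \<in> borel_measurable M" and S[measurable]: "S \<in> borel_measurable M"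
    and int: "integrable M (\<lambda>x. \<bar>f x\<bar> * exp (c * \<bar>S x\<bar>))"
  shows "continuous_on {0..c} (\<lambda>b. \<integral>x. f x * exp (b * S x) \<partial>M)"
  unfolding continuous_on_sequentially
proof (intro allI ballI impI, elim conjE)
  fix u a assume a: "a \<in> {0..c}" and u: "\<forall>n. u n \<in> {0..c}" and lim: "u \<longlonglongrightarrow> a"
  show "((\<lambda>b. \<integral>x. f x * exp (b * S x) \<partial>M) \<circ> u) \<longlonglongrightarrow> (\<integral>x. f x * exp (a * S x) \<partial>M)"
    unfolding o_def
  proof (rule integral_dominated_convergence[OF _ _ int])
    show "AE x in M. (\<lambda>i. f x * exp (u i * S x)) \<longlonglongrightarrow> f x * exp (a * S x)"
      using lim by (auto intro!: tendsto_intros)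
    fix n
    have "u n * S x \<le> c * \<bar>S x\<bar>" for x
    proof -
      have "u n * S x \<le> u n * \<bar>S x\<bar>" using u by (intro mult_left_mono) auto
      also have "\<dots> \<le> c * \<bar>S x\<bar>" using u by (intro mult_right_mono) auto
      finally show ?thesis .
    qed
    thus "AE x in M. norm (f x * exp (u n * S x)) \<le> \<bar>f x\<bar> * exp (c * \<bar>S x\<bar>)"
      by (auto simp: abs_mult intro!: mult_left_mono)
  qed auto
qed

text \<open>A weighted Pinsker inequality: optimising over \<open>l\<close> shows that the weighted \<open>L\<^sup>1\<close> distance
  of two densities is of the order of the square root of their relative entropy.
  Keeping \<open>l\<close> free avoids a case distinction on the size of the entropy.\<close>

lemma weighted_pinsker:
  fixes L b w :: "'b \<Rightarrow> real"
  assumes [measurable]: "L \<in> borel_measurable M" "b \<in> borel_measurable M" "w \<in> borel_measurable M"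
    and pos: "\<And>x. 0 \<le> L x" "\<And>x. 0 < b x" "\<And>x. 0 \<le> w x"
    and ent: "integrable M (\<lambda>x. L x * ln (L x) - L x * ln (b x) - L x + b x)"
    and mom: "integrable M (\<lambda>x. b x * ((w x)\<^sup>2 * exp (c * w x)))"
    and l: "0 < l" "l \<le> c"
  shows "integrable M (\<lambda>x. w x * \<bar>L x - b x\<bar>)"
    and "(\<integral>x. w x * \<bar>L x - b x\<bar> \<partial>M)
      \<le> (\<integral>x. L x * ln (L x) - L x * ln (b x) - L x + b x \<partial>M) / l
        + l * (\<integral>x. b x * ((w x)\<^sup>2 * exp (c * w x)) \<partial>M)"
proof -
  let ?e = "\<lambda>x. L x * ln (L x) - L x * ln (b x) - L x + b x"
  let ?m = "\<lambda>x. b x * ((w x)\<^sup>2 * exp (c * w x))"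
  have le: "w x * \<bar>L x - b x\<bar> \<le> ?e x / l + l * ?m x" for x
  proof -
    have "l * (w x * \<bar>L x - b x\<bar>) \<le> ?e x + b x * ((l * w x)\<^sup>2 * exp (l * w x) / 2)"
      using entropy_young[of "b x" "L x" "l * w x"] pos[of x] l by (simp add: mult.assoc)
    also have "\<dots> \<le> ?e x + b x * ((l * w x)\<^sup>2 * exp (c * w x) / 1)"
      using pos[of x] l by (intro add_left_mono mult_left_mono frac_le)
        (auto intro!: mult_left_mono mult_right_mono)
    finally show ?thesis using l by (simp add: field_simps power2_eq_square)
  qed
  have int: "integrable M (\<lambda>x. ?e x / l + l * ?m x)"
    using Bochner_Integration.integrable_add[OF integrable_mult_right[OF ent, of "1 / l"]
      integrable_mult_right[OF mom, of l]] by simp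
  show int': "integrable M (\<lambda>x. w x * \<bar>L x - b x\<bar>)"
    by (rule Bochner_Integration.integrable_bound[OF int])
       (use le pos in \<open>auto intro!: AE_I2 order_trans[OF _ abs_ge_self]\<close>)
  have "(\<integral>x. w x * \<bar>L x - b x\<bar> \<partial>M) \<le> (\<integral>x. ?e x / l + l * ?m x \<partial>M)"
    using le by (intro integral_mono int int') auto
  also have "\<dots> = (\<integral>x. ?e x \<partial>M) / l + l * (\<integral>x. ?m x \<partial>M)"
    using Bochner_Integration.integral_add[OF integrable_mult_right[OF ent, of "1 / l"]
      integrable_mult_right[OF mom, of l]] by simp
  finally show "(\<integral>x. w x * \<bar>L x - b x\<bar> \<partial>M) \<le> (\<integral>x. ?e x \<partial>M) / l + l * (\<integral>x. ?m x \<partial>M)" .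
qed

text \<open>The law of i.i.d. draws from a density is a product density; this reduces all expectations to
  integrals against the one measure \<open>iid T P\<close>.\<close>

lemma iid_density:
  fixes f :: "'b \<Rightarrow> real"
  assumes P: "prob_space P" and f[measurable]: "f \<in> borel_measurable P" and f0: "\<And>x. 0 \<le> f x"
    and Q: "prob_space (density P (\<lambda>x. ennreal (f x)))"
  shows "iid T (density P (\<lambda>x. ennreal (f x)))
    = density (iid T P) (\<lambda>x. ennreal (\<Prod>t\<in>{1..T}. f (x t)))"
proof -
  interpret P: prob_space P by fact
  interpret Q: prob_space "density P (\<lambda>x. ennreal (f x))" by fact
  interpret PP: product_sigma_finite "\<lambda>_::nat. P" by standard
  interpret QQ: product_sigma_finite "\<lambda>_::nat. density P (\<lambda>x. ennreal (f x))" by standard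
  show ?thesis
  proof (rule QQ.PiM_eqI[symmetric])
    show "sets (density (iid T P) (\<lambda>x. ennreal (\<Prod>t\<in>{1..T}. f (x t))))
        = sets (iid T (density P (\<lambda>x. ennreal (f x))))"
      by (simp cong: sets_PiM_cong)
    fix A assume "\<And>i. i \<in> {1..T} \<Longrightarrow> A i \<in> sets (density P (\<lambda>x. ennreal (f x)))"
    hence A[measurable]: "\<And>i. i \<in> {1..T} \<Longrightarrow> A i \<in> sets P" by simp
    have "emeasure (density (iid T P) (\<lambda>x. ennreal (\<Prod>t\<in>{1..T}. f (x t)))) (Pi\<^sub>E {1..T} A)
      = (\<integral>\<^sup>+x. ennreal (\<Prod>t\<in>{1..T}. f (x t)) * indicator (Pi\<^sub>E {1..T} A) x \<partial>iid T P)"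
      by (intro emeasure_density sets_PiM_I_finite) (auto simp: A)
    also have "\<dots> = (\<integral>\<^sup>+x. (\<Prod>t\<in>{1..T}. ennreal (f (x t)) * indicator (A t) (x t)) \<partial>iid T P)"
    proof (intro nn_integral_cong)
      fix x assume "x \<in> space (iid T P)"
      hence "x \<in> extensional {1..T}" by (auto simp: space_PiM PiE_def)
      hence "indicator (Pi\<^sub>E {1..T} A) x = (\<Prod>t\<in>{1..T}. indicator (A t) (x t) :: ennreal)"
        by (auto simp: indicator_def PiE_def Pi_iff prod_eq_1_iff)
      thus "ennreal (\<Prod>t\<in>{1..T}. f (x t)) * indicator (Pi\<^sub>E {1..T} A) x
          = (\<Prod>t\<in>{1..T}. ennreal (f (x t)) * indicator (A t) (x t))"
        by (simp add: prod.distrib prod_ennreal f0)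
    qed
    also have "\<dots> = (\<Prod>t\<in>{1..T}. \<integral>\<^sup>+y. ennreal (f y) * indicator (A t) y \<partial>P)"
      by (intro PP.product_nn_integral_prod) auto
    also have "\<dots> = (\<Prod>t\<in>{1..T}. emeasure (density P (\<lambda>x. ennreal (f x))) (A t))"
      by (intro prod.cong refl emeasure_density[symmetric]) auto
    finally show "emeasure (density (iid T P) (\<lambda>x. ennreal (\<Prod>t\<in>{1..T}. f (x t)))) (Pi\<^sub>E {1..T} A)
      = (\<Prod>t\<in>{1..T}. emeasure (density P (\<lambda>x. ennreal (f x))) (A t))" .
  qed simp
qed

lemma iid_one_coordinate:
  fixes w f :: "'b \<Rightarrow> real"
  assumes P: "prob_space P" and w: "integrable P w" and wf: "integrable P (\<lambda>x. w x * f x)"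
    and s: "s \<in> {1..T}"
  shows "integrable (iid T P) (\<lambda>y. (\<Prod>t\<in>{1..T}. w (y t)) * f (y s))"
    and "(\<integral>y. (\<Prod>t\<in>{1..T}. w (y t)) * f (y s) \<partial>iid T P) = (\<integral>x. w x * f x \<partial>P) * (\<integral>x. w x \<partial>P) ^ (T - 1)"
proof -
  interpret P: prob_space P by fact
  interpret PP: product_sigma_finite "\<lambda>_::nat. P" by standard
  define u where "u t x = (if t = s then w x * f x else w x)" for t x
  have u: "integrable P (u t)" for t
    using w wf by (cases "t = s") (simp_all add: u_def[abs_def])
  have eq: "(\<lambda>y. (\<Prod>t\<in>{1..T}. w (y t)) * f (y s)) = (\<lambda>y. \<Prod>t\<in>{1..T}. u t (y t))"
  proof
    fix y
    have "(\<Prod>t\<in>{1..T} - {s}. u t (y t)) = (\<Prod>t\<in>{1..T} - {s}. w (y t))"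
      by (intro prod.cong) (auto simp: u_def)
    thus "(\<Prod>t\<in>{1..T}. w (y t)) * f (y s) = (\<Prod>t\<in>{1..T}. u t (y t))"
      using s by (simp add: prod.remove[where x = s] u_def)
  qed
  show "integrable (iid T P) (\<lambda>y. (\<Prod>t\<in>{1..T}. w (y t)) * f (y s))"
    unfolding eq using u by (intro PP.product_integrable_prod) auto
  have "(\<integral>y. (\<Prod>t\<in>{1..T}. u t (y t)) \<partial>iid T P) = (\<Prod>t\<in>{1..T}. \<integral>x. u t x \<partial>P)"
    using u by (intro PP.product_integral_prod) auto
  also have "\<dots> = (\<integral>x. u s x \<partial>P) * (\<Prod>t\<in>{1..T} - {s}. \<integral>x. u t x \<partial>P)"
    using s by (intro prod.remove) auto
  also have "(\<Prod>t\<in>{1..T} - {s}. \<integral>x. u t x \<partial>P) = (\<Prod>t\<in>{1..T} - {s}. \<integral>x. w x \<partial>P)"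
    by (intro prod.cong) (auto simp: u_def)
  finally show "(\<integral>y. (\<Prod>t\<in>{1..T}. w (y t)) * f (y s) \<partial>iid T P)
      = (\<integral>x. w x * f x \<partial>P) * (\<integral>x. w x \<partial>P) ^ (T - 1)"
    unfolding eq using s by (simp add: u_def)
qed

lemma integral_double_sum:
  fixes f :: "'i \<Rightarrow> 'j \<Rightarrow> 'b \<Rightarrow> real"
  assumes "\<And>i j. i \<in> I \<Longrightarrow> j \<in> J i \<Longrightarrow> integrable M (f i j)"
  shows "(\<integral>x. (\<Sum>i\<in>I. \<Sum>j\<in>J i. f i j x) \<partial>M) = (\<Sum>i\<in>I. \<Sum>j\<in>J i. \<integral>x. f i j x \<partial>M)"
  using assms by (simp add: Bochner_Integration.integral_sum cong: sum.cong)

text \<open>Since products of two centred coordinates have mean zero, subtracting constants from \<open>h\<close> or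
  from its conditional expectations leaves the off-diagonal second-order terms unchanged.\<close>

lemma iid_pair_product:
  fixes f :: "'b \<Rightarrow> real"
  assumes P: "prob_space P" and f: "integrable P f" "(\<integral>x. f x \<partial>P) = 0"
    and t: "t \<in> {1..T}" and s: "s \<in> {1..T}" and ts: "s \<noteq> t"
  shows "integrable (iid T P) (\<lambda>y. f (y t) * f (y s))" "(\<integral>y. f (y t) * f (y s) \<partial>iid T P) = 0"
proof -
  interpret P: prob_space P by fact
  interpret PP: product_sigma_finite "\<lambda>_::nat. P" by standard
  define u where "u r x = (if r = t \<or> r = s then f x else 1)" for r x
  have u: "integrable P (u r)" for r
    using f(1) by (cases "r = t \<or> r = s") (simp_all add: u_def[abs_def])
  have eq: "(\<lambda>y. f (y t) * f (y s)) = (\<lambda>y. \<Prod>r\<in>{1..T}. u r (y r))"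
  proof
    fix y
    have "(\<Prod>r\<in>{1..T} - {t} - {s}. u r (y r)) = 1" by (intro prod.neutral) (auto simp: u_def)
    thus "f (y t) * f (y s) = (\<Prod>r\<in>{1..T}. u r (y r))"
      using t s ts by (simp add: prod.remove[where x = t] prod.remove[where x = s and A = "_ - {t}"] u_def)
  qed
  show "integrable (iid T P) (\<lambda>y. f (y t) * f (y s))"
    unfolding eq using u by (intro PP.product_integrable_prod) auto
  have "(\<integral>y. (\<Prod>r\<in>{1..T}. u r (y r)) \<partial>iid T P) = (\<Prod>r\<in>{1..T}. \<integral>x. u r x \<partial>P)"
    using u by (intro PP.product_integral_prod) auto
  also have "\<dots> = 0" by (rule prod_zero) (use t f in \<open>auto simp: u_def intro!: bexI[of _ t]\<close>)
  finally show "(\<integral>y. f (y t) * f (y s) \<partial>iid T P) = 0" unfolding eq .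
qed

section \<open>The exponential family generated by the gradient\<close>

lemma bigo_at_right_0I:
  fixes f :: "real \<Rightarrow> real"
  assumes "0 < c" "\<And>b. 0 < b \<Longrightarrow> b \<le> c \<Longrightarrow> \<bar>f b\<bar> \<le> C * b ^ n"
  shows "f \<in> O[at_right 0](\<lambda>b. b ^ n)"
proof (rule bigoI[where c = C])
  show "\<forall>\<^sub>F b in at_right 0. norm (f b) \<le> C * norm (b ^ n)"
    using eventually_at_right_real[OF assms(1)]
    by eventually_elim (use assms(2) in auto)
qed

lemma monomial_in_bigo:
  fixes c :: real
  assumes "n \<le> m"
  shows "(\<lambda>b. b ^ m * c) \<in> O[at_right 0](\<lambda>b. b ^ n)"
  by (rule bigo_at_right_0I[where c = 1 and C = "\<bar>c\<bar>"])
     (use assms in \<open>auto simp: abs_mult mult.commute intro!: mult_left_mono power_decreasing\<close>)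

text \<open>The setting for centred \<open>h\<close>. The weight \<open>w\<close> absorbs all constants, the product bound on
  \<open>h\<close> makes every integral against a product measure factorise, and \<open>gradient\<close> says that
  \<open>g\<close> is the derivative at \<open>P\<close> of the expectation of \<open>h\<close> under \<open>T\<close> i.i.d. draws.\<close>

locale dominated_functional = prob_space P for P :: "'a measure" +
  fixes T :: nat and h :: "(nat \<Rightarrow> 'a) \<Rightarrow> real" and w g :: "'a \<Rightarrow> real" and \<theta> :: real
  assumes T_pos: "0 < T"
    and h_meas[measurable]: "h \<in> borel_measurable (iid T P)"
    and w_meas[measurable]: "w \<in> borel_measurable P"
    and g_meas[measurable]: "g \<in> borel_measurable P"
    and w_ge_1: "1 \<le> w x"
    and g_le_w: "\<bar>g x\<bar> \<le> w x"
    and h_le_w: "y \<in> space (iid T P) \<Longrightarrow> \<bar>h y\<bar> \<le> (\<Prod>t\<in>{1..T}. w (y t))"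
    and \<theta>_pos: "0 < \<theta>"
    and exp_w: "integrable P (\<lambda>x. exp (\<theta> * w x))"
    and h_mean: "(\<integral>y. h y \<partial>iid T P) = 0"
    and gradient: "\<phi> \<in> borel_measurable P \<Longrightarrow> integrable P (\<lambda>x. w x * \<phi> x) \<Longrightarrow>
      (\<integral>y. h y * (\<Sum>t\<in>{1..T}. \<phi> (y t)) \<partial>iid T P) = (\<integral>x. g x * \<phi> x \<partial>P)"
    and g_var_pos: "0 < (\<integral>x. (g x)\<^sup>2 \<partial>P)"
begin

interpretation PP: product_sigma_finite "\<lambda>_::nat. P" by standard

lemma w_nonneg[simp]: "0 \<le> w x"
  using w_ge_1[of x] by simp

lemma integrable_weight:
  assumes [measurable]: "f \<in> borel_measurable P"
    and le: "\<And>x. \<bar>f x\<bar> \<le> C * (w x ^ k * exp (\<theta> / 2 * w x))"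
  shows "integrable P f"
proof (rule Bochner_Integration.integrable_bound[OF integrable_mult_right[OF exp_w,
      of "\<bar>C\<bar> * (fact k / (\<theta> / 2) ^ k)"]])
  show "AE x in P. norm (f x) \<le> norm (\<bar>C\<bar> * (fact k / (\<theta> / 2) ^ k) * exp (\<theta> * w x))"
  proof (rule AE_I2)
    fix x
    have "\<bar>f x\<bar> \<le> C * (w x ^ k * exp (\<theta> / 2 * w x))" by (rule le)
    also have "\<dots> \<le> \<bar>C\<bar> * (w x ^ k * exp (\<theta> / 2 * w x))"
      by (intro mult_right_mono) auto
    also have "\<dots> \<le> \<bar>C\<bar> * (fact k / (\<theta> / 2) ^ k * exp (\<theta> / 2 * w x) * exp (\<theta> / 2 * w x))"
      using \<theta>_pos by (intro mult_left_mono mult_right_mono power_le_exp) auto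
    also have "exp (\<theta> / 2 * w x) * exp (\<theta> / 2 * w x) = exp (\<theta> * w x)"
      by (simp flip: exp_add)
    hence "\<bar>C\<bar> * (fact k / (\<theta> / 2) ^ k * exp (\<theta> / 2 * w x) * exp (\<theta> / 2 * w x))
        = \<bar>C\<bar> * (fact k / (\<theta> / 2) ^ k) * exp (\<theta> * w x)"
      by (simp add: mult.assoc)
    finally show "norm (f x) \<le> norm (\<bar>C\<bar> * (fact k / (\<theta> / 2) ^ k) * exp (\<theta> * w x))"
      using \<theta>_pos by (simp add: abs_mult)
  qed
qed simp

lemma integrable_w_exp: "c \<le> \<theta> / 2 \<Longrightarrow> integrable P (\<lambda>x. w x ^ k * exp (c * w x))"
  by (rule integrable_weight[where C = 1 and k = k])
     (auto simp: abs_mult simp del: times_divide_eq_left intro!: mult_left_mono mult_right_mono)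

lemma integrable_w_power: "integrable P (\<lambda>x. w x ^ k)"
  using integrable_w_exp[of 0 k] \<theta>_pos by simp

lemma integrable_iid:
  fixes f :: "(nat \<Rightarrow> 'a) \<Rightarrow> real" and v :: "nat \<Rightarrow> 'a \<Rightarrow> real"
  assumes f: "f \<in> borel_measurable (iid T P)" and v: "\<And>t. integrable P (v t)"
    and le: "\<And>y. y \<in> space (iid T P) \<Longrightarrow> \<bar>f y\<bar> \<le> C * (\<Prod>t\<in>{1..T}. v t (y t))"
  shows "integrable (iid T P) f"
proof (rule Bochner_Integration.integrable_bound)
  show "integrable (iid T P) (\<lambda>y. C * (\<Prod>t\<in>{1..T}. v t (y t)))"
    by (intro integrable_mult_right PP.product_integrable_prod v) auto
  show "AE y in iid T P. norm (f y) \<le> norm (C * (\<Prod>t\<in>{1..T}. v t (y t)))"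
    using le by (intro AE_I2) (auto intro: order_trans[OF _ abs_ge_self] simp del: One_nat_def)
qed (rule f)

definition S :: "(nat \<Rightarrow> 'a) \<Rightarrow> real" where "S y = (\<Sum>t\<in>{1..T}. g (y t))"

lemma S_meas[measurable]: "S \<in> borel_measurable (iid T P)"
  unfolding S_def by measurable

lemma integrable_h_S_exp:
  "integrable (iid T P) (\<lambda>y. \<bar>h y\<bar> * \<bar>S y\<bar> ^ n * exp (\<theta> / 4 * \<bar>S y\<bar>))"
proof (rule integrable_iid[where v = "\<lambda>_ x. 2 / \<theta> * exp (\<theta> * w x)" and C = "fact n / (\<theta> / 4) ^ n"])
  show "integrable P (\<lambda>x. 2 / \<theta> * exp (\<theta> * w x))"
    using exp_w by simp
  fix y assume y: "y \<in> space (iid T P)"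
  have "\<bar>S y\<bar> \<le> (\<Sum>t\<in>{1..T}. w (y t))"
    unfolding S_def by (intro sum_abs[THEN order_trans] sum_mono g_le_w)
  hence "\<theta> / 4 * \<bar>S y\<bar> + \<theta> / 4 * \<bar>S y\<bar> \<le> \<theta> / 2 * (\<Sum>t\<in>{1..T}. w (y t))"
    using \<theta>_pos by simp
  hence "exp (\<theta> / 4 * \<bar>S y\<bar>) * exp (\<theta> / 4 * \<bar>S y\<bar>) \<le> exp (\<theta> / 2 * (\<Sum>t\<in>{1..T}. w (y t)))"
    by (simp flip: exp_add)
  also have "\<dots> = (\<Prod>t\<in>{1..T}. exp (\<theta> / 2 * w (y t)))"
    by (simp add: exp_sum sum_distrib_left)
  finally have e: "exp (\<theta> / 4 * \<bar>S y\<bar>) * exp (\<theta> / 4 * \<bar>S y\<bar>) \<le> (\<Prod>t\<in>{1..T}. exp (\<theta> / 2 * w (y t)))" .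
  have "\<bar>S y\<bar> ^ n * exp (\<theta> / 4 * \<bar>S y\<bar>)
      \<le> fact n / (\<theta> / 4) ^ n * exp (\<theta> / 4 * \<bar>S y\<bar>) * exp (\<theta> / 4 * \<bar>S y\<bar>)"
    using \<theta>_pos by (intro mult_right_mono power_le_exp) auto
  also have "\<dots> \<le> fact n / (\<theta> / 4) ^ n * (\<Prod>t\<in>{1..T}. exp (\<theta> / 2 * w (y t)))"
    using mult_left_mono[OF e, of "fact n / (\<theta> / 4) ^ n"] \<theta>_pos by (simp add: mult.assoc)
  finally have Sn: "\<bar>S y\<bar> ^ n * exp (\<theta> / 4 * \<bar>S y\<bar>)
      \<le> fact n / (\<theta> / 4) ^ n * (\<Prod>t\<in>{1..T}. exp (\<theta> / 2 * w (y t)))" .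
  have "\<bar>h y\<bar> \<le> (\<Prod>t\<in>{1..T}. w (y t))" by (rule h_le_w[OF y])
  also have "\<dots> \<le> (\<Prod>t\<in>{1..T}. 2 / \<theta> * exp (\<theta> / 2 * w (y t)))"
  proof (intro prod_mono conjI)
    fix t show "w (y t) \<le> 2 / \<theta> * exp (\<theta> / 2 * w (y t))"
      using power_le_exp[of "w (y t)" "\<theta> / 2" 1] \<theta>_pos by simp
  qed auto
  finally have hn: "\<bar>h y\<bar> \<le> (\<Prod>t\<in>{1..T}. 2 / \<theta> * exp (\<theta> / 2 * w (y t)))" .
  have "\<bar>h y\<bar> * (\<bar>S y\<bar> ^ n * exp (\<theta> / 4 * \<bar>S y\<bar>))
      \<le> (\<Prod>t\<in>{1..T}. 2 / \<theta> * exp (\<theta> / 2 * w (y t)))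
        * (fact n / (\<theta> / 4) ^ n * (\<Prod>t\<in>{1..T}. exp (\<theta> / 2 * w (y t))))"
    using \<theta>_pos by (intro mult_mono hn Sn) (auto intro!: prod_nonneg)
  also have "\<dots> = fact n / (\<theta> / 4) ^ n
      * (\<Prod>t\<in>{1..T}. 2 / \<theta> * exp (\<theta> / 2 * w (y t)) * exp (\<theta> / 2 * w (y t)))"
    by (simp only: prod.distrib mult_ac)
  also have "(\<lambda>t. 2 / \<theta> * exp (\<theta> / 2 * w (y t)) * exp (\<theta> / 2 * w (y t)))
      = (\<lambda>t. 2 / \<theta> * exp (\<theta> * w (y t)))"
    by (simp add: mult.assoc flip: exp_add)
  finally show "\<bar>\<bar>h y\<bar> * \<bar>S y\<bar> ^ n * exp (\<theta> / 4 * \<bar>S y\<bar>)\<bar>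
      \<le> fact n / (\<theta> / 4) ^ n * (\<Prod>t\<in>{1..T}. 2 / \<theta> * exp (\<theta> * w (y t)))"
    by (simp add: mult.assoc)
qed measurable

lemma integrable_h_S_power: "integrable (iid T P) (\<lambda>y. h y * S y ^ k)"
proof (rule Bochner_Integration.integrable_bound[OF integrable_h_S_exp[of k]])
  show "AE y in iid T P. norm (h y * S y ^ k) \<le> norm (\<bar>h y\<bar> * \<bar>S y\<bar> ^ k * exp (\<theta> / 4 * \<bar>S y\<bar>))"
  proof (rule AE_I2)
    fix y
    have "\<bar>h y\<bar> * \<bar>S y\<bar> ^ k * 1 \<le> \<bar>h y\<bar> * \<bar>S y\<bar> ^ k * exp (\<theta> / 4 * \<bar>S y\<bar>)"
      using \<theta>_pos by (intro mult_left_mono) auto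
    thus "norm (h y * S y ^ k) \<le> norm (\<bar>h y\<bar> * \<bar>S y\<bar> ^ k * exp (\<theta> / 4 * \<bar>S y\<bar>))"
      by (simp add: abs_mult power_abs)
  qed
qed measurable

lemma integrable_g_exp:
  "integrable P (\<lambda>x. \<bar>g x ^ k\<bar> * \<bar>g x\<bar> ^ n * exp (\<theta> / 4 * \<bar>g x\<bar>))"
proof (rule integrable_weight[where C = 1 and k = "k + n"])
  fix x
  have "\<bar>g x\<bar> ^ (k + n) * exp (\<theta> / 4 * \<bar>g x\<bar>) \<le> w x ^ (k + n) * exp (\<theta> / 2 * w x)"
  proof (rule mult_mono)
    have "\<theta> / 4 * \<bar>g x\<bar> \<le> \<theta> / 2 * w x"
      using g_le_w[of x] \<theta>_pos by (intro mult_mono) auto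
    thus "exp (\<theta> / 4 * \<bar>g x\<bar>) \<le> exp (\<theta> / 2 * w x)" by simp
  qed (auto intro!: power_mono g_le_w)
  thus "\<bar>\<bar>g x ^ k\<bar> * \<bar>g x\<bar> ^ n * exp (\<theta> / 4 * \<bar>g x\<bar>)\<bar>
      \<le> 1 * (w x ^ (k + n) * exp (\<theta> / 2 * w x))"
    by (simp add: abs_mult power_add power_abs)
qed measurable

lemma integrable_g_power: "integrable P (\<lambda>x. g x ^ k)"
  by (rule Bochner_Integration.integrable_bound[OF integrable_w_power[of k]])
     (auto simp: power_abs intro!: power_mono g_le_w)

lemma g_mean: "(\<integral>x. g x \<partial>P) = 0"
  using gradient[of "\<lambda>_. 1"] integrable_w_power[of 1] h_mean by simp

definition Z :: "real \<Rightarrow> real" where "Z b = (\<integral>x. exp (b * g x) \<partial>P)"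
definition M :: "real \<Rightarrow> real" where "M b = (\<integral>x. g x * exp (b * g x) \<partial>P)"
definition V :: real where "V = (\<integral>x. (g x)\<^sup>2 \<partial>P)"
definition \<kappa> :: real where "\<kappa> = (\<integral>x. g x ^ 3 \<partial>P)"

text \<open>The second derivative at \<open>b = 0\<close> of the expectation of \<open>h\<close> under the tilted law.\<close>

definition H2 :: real where "H2 = (\<integral>y. h y * (S y)\<^sup>2 \<partial>iid T P)"

definition tilt :: "real \<Rightarrow> 'a \<Rightarrow> real" where "tilt b x = exp (b * g x) / Z b"

text \<open>The relative entropy of the tilted law with respect to \<open>P\<close>.\<close>

definition ent :: "real \<Rightarrow> real" where "ent b = b * (M b / Z b) - ln (Z b)"

definition payoff :: "('a \<Rightarrow> real) \<Rightarrow> real" where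
  "payoff L = (\<integral>y. h y * (\<Prod>t\<in>{1..T}. L (y t)) \<partial>iid T P)"

lemma V_pos: "0 < V"
  using g_var_pos by (simp add: V_def)

lemma tilt_meas[measurable]: "tilt b \<in> borel_measurable P"
  unfolding tilt_def by measurable

lemma exp_integrable:
  assumes "0 \<le> b" "b \<le> \<theta> / 4"
  shows "integrable P (\<lambda>x. exp (b * g x))" "integrable P (\<lambda>x. g x * exp (b * g x))"
  using exp_moment_taylor(1)[of "\<lambda>x. g x ^ 0" P g 0 "\<theta> / 4" b]
    exp_moment_taylor(1)[of "\<lambda>x. g x ^ 1" P g 0 "\<theta> / 4" b]
    integrable_g_exp[of 0 0] integrable_g_exp[of 1 0] assms by simp_all

lemma Z_taylor: "(\<lambda>b. Z b - (1 + b\<^sup>2 / 2 * V + b ^ 3 / 6 * \<kappa>)) \<in> O[at_right 0](\<lambda>b. b ^ 4)"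
proof (rule bigo_at_right_0I)
  show "0 < \<theta> / 4" using \<theta>_pos by simp
  fix b :: real assume b: "0 < b" "b \<le> \<theta> / 4"
  have "\<bar>(\<integral>x. 1 * exp (b * g x) \<partial>P) - (\<Sum>k<4. b ^ k / fact k * (\<integral>x. 1 * g x ^ k \<partial>P))\<bar>
      \<le> b ^ 4 * (\<integral>x. \<bar>1\<bar> * \<bar>g x\<bar> ^ 4 * exp (\<theta> / 4 * \<bar>g x\<bar>) \<partial>P)"
    by (rule exp_moment_taylor(2)) (use integrable_g_exp[of 0 4] integrable_g_power b in simp_all)
  thus "\<bar>Z b - (1 + b\<^sup>2 / 2 * V + b ^ 3 / 6 * \<kappa>)\<bar>
      \<le> (\<integral>x. \<bar>g x\<bar> ^ 4 * exp (\<theta> / 4 * \<bar>g x\<bar>) \<partial>P) * b ^ 4"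
    by (simp add: Z_def V_def \<kappa>_def eval_nat_numeral g_mean prob_space mult.commute)
qed

lemma M_taylor: "(\<lambda>b. M b - (b * V + b\<^sup>2 / 2 * \<kappa>)) \<in> O[at_right 0](\<lambda>b. b ^ 3)"
proof (rule bigo_at_right_0I)
  show "0 < \<theta> / 4" using \<theta>_pos by simp
  fix b :: real assume b: "0 < b" "b \<le> \<theta> / 4"
  have "\<bar>(\<integral>x. g x * exp (b * g x) \<partial>P) - (\<Sum>k<3. b ^ k / fact k * (\<integral>x. g x * g x ^ k \<partial>P))\<bar>
      \<le> b ^ 3 * (\<integral>x. \<bar>g x\<bar> * \<bar>g x\<bar> ^ 3 * exp (\<theta> / 4 * \<bar>g x\<bar>) \<partial>P)"
    by (rule exp_moment_taylor(2))
       (use integrable_g_exp[of 1 3] integrable_g_power[of "Suc k" for k] b in simp_all)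
  thus "\<bar>M b - (b * V + b\<^sup>2 / 2 * \<kappa>)\<bar>
      \<le> (\<integral>x. \<bar>g x\<bar> * \<bar>g x\<bar> ^ 3 * exp (\<theta> / 4 * \<bar>g x\<bar>) \<partial>P) * b ^ 3"
    by (simp add: M_def V_def \<kappa>_def eval_nat_numeral g_mean prob_space mult.commute)
qed

text \<open>The first derivative at \<open>b = 0\<close> of the expectation of \<open>h\<close> under the tilted law: \<open>gradient\<close> in the direction
  \<open>g\<close> itself.\<close>

lemma h_S: "(\<integral>y. h y * S y \<partial>iid T P) = V"
proof -
  have "integrable P (\<lambda>x. w x * g x)"
    by (rule Bochner_Integration.integrable_bound[OF integrable_w_power[of 2]])
       (auto simp: abs_mult power2_eq_square intro!: mult_left_mono g_le_w)
  from gradient[OF _ this] show ?thesis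
    by (simp add: S_def V_def power2_eq_square)
qed

lemma h_exp_taylor:
  "(\<lambda>b. (\<integral>y. h y * exp (b * S y) \<partial>iid T P) - (b * V + b\<^sup>2 / 2 * H2)) \<in> O[at_right 0](\<lambda>b. b ^ 3)"
proof (rule bigo_at_right_0I)
  show "0 < \<theta> / 4" using \<theta>_pos by simp
  fix b :: real assume b: "0 < b" "b \<le> \<theta> / 4"
  have "\<bar>(\<integral>y. h y * exp (b * S y) \<partial>iid T P) - (\<Sum>k<3. b ^ k / fact k * (\<integral>y. h y * S y ^ k \<partial>iid T P))\<bar>
      \<le> b ^ 3 * (\<integral>y. \<bar>h y\<bar> * \<bar>S y\<bar> ^ 3 * exp (\<theta> / 4 * \<bar>S y\<bar>) \<partial>iid T P)"
    by (rule exp_moment_taylor(2)) (use integrable_h_S_exp[of 3] integrable_h_S_power b in \<open>simp_all del: One_nat_def\<close>)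
  thus "\<bar>(\<integral>y. h y * exp (b * S y) \<partial>iid T P) - (b * V + b\<^sup>2 / 2 * H2)\<bar>
      \<le> (\<integral>y. \<bar>h y\<bar> * \<bar>S y\<bar> ^ 3 * exp (\<theta> / 4 * \<bar>S y\<bar>) \<partial>iid T P) * b ^ 3"
    using h_mean h_S by (simp add: H2_def eval_nat_numeral mult.commute)
qed

lemma Z_ge_1:
  assumes "0 \<le> b" "b \<le> \<theta> / 4"
  shows "1 \<le> Z b"
proof -
  have "(\<integral>x. 1 + b * g x \<partial>P) \<le> Z b"
    unfolding Z_def using exp_integrable[OF assms] integrable_g_power[of 1]
    by (intro integral_mono) (auto intro: exp_ge_add_one_self)
  thus ?thesis
    using integrable_g_power[of 1] by (simp add: g_mean prob_space)
qed

lemma tilt_pos: "0 \<le> b \<Longrightarrow> b \<le> \<theta> / 4 \<Longrightarrow> 0 < tilt b x"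
  using Z_ge_1[of b] by (simp add: tilt_def)

lemma ln_tilt: "0 \<le> b \<Longrightarrow> b \<le> \<theta> / 4 \<Longrightarrow> ln (tilt b x) = b * g x - ln (Z b)"
  using Z_ge_1[of b] by (simp add: tilt_def ln_div)

lemma tilt_mean: "0 \<le> b \<Longrightarrow> b \<le> \<theta> / 4 \<Longrightarrow> (\<integral>x. tilt b x \<partial>P) = 1"
  using Z_ge_1[of b] by (simp add: tilt_def flip: Z_def)

lemma integral_g_tilt: "(\<integral>x. g x * tilt b x \<partial>P) = M b / Z b"
  by (simp add: tilt_def M_def)

lemma continuous_on_ent: "continuous_on {0..\<theta> / 4} ent"
proof -
  have "continuous_on {0..\<theta> / 4} Z" "continuous_on {0..\<theta> / 4} M"
    using continuous_on_exp_moment[of "\<lambda>_. 1" P g "\<theta> / 4"] continuous_on_exp_moment[of g P g "\<theta> / 4"]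
      integrable_g_exp[of 0 0] integrable_g_exp[of 1 0] by (simp_all add: Z_def[abs_def] M_def[abs_def])
  moreover have "Z b \<noteq> 0" "Z b > 0" if "b \<in> {0..\<theta> / 4}" for b
    using Z_ge_1[of b] that by auto
  ultimately show ?thesis unfolding ent_def by (auto intro!: continuous_intros)
qed

lemma ent_0: "ent 0 = 0"
  by (simp add: ent_def Z_def prob_space)

lemma eventually_range: "\<forall>\<^sub>F b in at_right 0. 0 < b \<and> b \<le> \<theta> / 4"
  using eventually_at_right_real[of 0 "\<theta> / 4"] \<theta>_pos by (auto elim!: eventually_mono)

lemma Z_minus_1: "(\<lambda>b. Z b - 1) \<in> O[at_right 0](\<lambda>b. b\<^sup>2)"
proof -
  have "(\<lambda>b::real. b ^ 4) \<in> O[at_right 0](\<lambda>b. b\<^sup>2)" using monomial_in_bigo[of 2 4 1] by simp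
  from landau_o.big.trans[OF Z_taylor this]
  have "(\<lambda>b. (Z b - (1 + b\<^sup>2 / 2 * V + b ^ 3 / 6 * \<kappa>)) + (b\<^sup>2 / 2 * V + b ^ 3 / 6 * \<kappa>))
      \<in> O[at_right 0](\<lambda>b. b\<^sup>2)"
    using monomial_in_bigo[of 2 2 "V / 2"] monomial_in_bigo[of 2 3 "\<kappa> / 6"]
    by (intro sum_in_bigo(1)) simp_all
  thus ?thesis by simp
qed

lemma inverse_Z_power: "(\<lambda>b. 1 - inverse (Z b) ^ n) \<in> O[at_right 0](\<lambda>b. b\<^sup>2)"
proof (rule landau_o.big.trans[OF bigoI[where c = "real n"] Z_minus_1])
  show "\<forall>\<^sub>F b in at_right 0. norm (1 - inverse (Z b) ^ n) \<le> real n * norm (Z b - 1)"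
    using eventually_range
  proof eventually_elim
    case (elim b)
    hence Z: "1 \<le> Z b" using Z_ge_1 by simp
    have "1 + real n * (inverse (Z b) - 1) \<le> (1 + (inverse (Z b) - 1)) ^ n"
      using Z by (intro Bernoulli_inequality) auto
    hence "1 - inverse (Z b) ^ n \<le> real n * (1 - inverse (Z b))" by (simp add: algebra_simps)
    also have "1 - inverse (Z b) \<le> Z b - 1"
      using Z mult_nonneg_nonneg[of "Z b - 1" "Z b - 1"] by (simp add: field_simps)
    finally have "1 - inverse (Z b) ^ n \<le> real n * (Z b - 1)" by (simp add: mult_left_mono)
    moreover have "inverse (Z b) ^ n \<le> 1" using Z by (simp add: power_le_one inverse_le_1_iff)
    ultimately show ?case using Z by simp
  qed
qed

text \<open>The cubic coefficient is \<open>\<kappa> / 2 - \<kappa> / 6\<close>, from \<open>b * M b\<close> and from \<open>ln (Z b)\<close>. Dividing \<open>M\<close> by \<open>Z\<close>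
  and replacing \<open>ln (Z b)\<close> by \<open>Z b - 1\<close> only matters at order \<open>b\<^sup>4\<close>, since \<open>Z b - 1\<close> is
  of order \<open>b\<^sup>2\<close>.\<close>

lemma ent_taylor: "(\<lambda>b. ent b - (b\<^sup>2 / 2 * V + b ^ 3 / 3 * \<kappa>)) \<in> O[at_right 0](\<lambda>b. b ^ 4)"
proof -
  have Mb: "M \<in> O[at_right 0](\<lambda>b. b)"
  proof -
    have "(\<lambda>b::real. b ^ 3) \<in> O[at_right 0](\<lambda>b. b)" using monomial_in_bigo[of 1 3 1] by simp
    from landau_o.big.trans[OF M_taylor this]
    have "(\<lambda>b. (M b - (b * V + b\<^sup>2 / 2 * \<kappa>)) + (b * V + b\<^sup>2 / 2 * \<kappa>)) \<in> O[at_right 0](\<lambda>b. b)"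
      using monomial_in_bigo[of 1 1 V] monomial_in_bigo[of 1 2 "\<kappa> / 2"]
      by (intro sum_in_bigo(1)) simp_all
    thus ?thesis by simp
  qed
  have 1: "(\<lambda>b. b * (M b - (b * V + b\<^sup>2 / 2 * \<kappa>))) \<in> O[at_right 0](\<lambda>b. b ^ 4)"
    using landau_o.big.mult[OF landau_o.big_refl[of "\<lambda>b. b"] M_taylor] by (simp add: eval_nat_numeral)
  have 2: "(\<lambda>b. b * (M b * (1 - inverse (Z b) ^ 1))) \<in> O[at_right 0](\<lambda>b. b ^ 4)"
    using landau_o.big.mult[OF landau_o.big_refl[of "\<lambda>b. b"] landau_o.big.mult[OF Mb inverse_Z_power[of 1]]]
    by (simp add: eval_nat_numeral)
  have 3: "(\<lambda>b. ln (Z b) - (Z b - 1)) \<in> O[at_right 0](\<lambda>b. b ^ 4)"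
  proof (rule landau_o.big.trans)
    show "(\<lambda>b. (Z b - 1)\<^sup>2) \<in> O[at_right 0](\<lambda>b. b ^ 4)"
      using landau_o.big_power[OF Z_minus_1, of 2] by simp
    show "(\<lambda>b. ln (Z b) - (Z b - 1)) \<in> O[at_right 0](\<lambda>b. (Z b - 1)\<^sup>2)"
    proof (rule bigoI[where c = 1])
      show "\<forall>\<^sub>F b in at_right 0. norm (ln (Z b) - (Z b - 1)) \<le> 1 * norm ((Z b - 1)\<^sup>2)"
        using eventually_range
      proof eventually_elim
        case (elim b)
        hence Z: "1 \<le> Z b" using Z_ge_1 by simp
        have "ln (Z b) \<le> Z b - 1" using Z by (intro ln_le_minus_one) auto
        moreover have "1 - inverse (Z b) \<le> ln (Z b)"
          using ln_le_minus_one[of "inverse (Z b)"] Z by (simp add: ln_inverse)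
        moreover have "(Z b - 1) - (1 - inverse (Z b)) \<le> (Z b - 1)\<^sup>2"
        proof -
          have "(Z b - 1) - (1 - inverse (Z b)) = (Z b - 1)\<^sup>2 / Z b"
            using Z by (simp add: field_simps power2_eq_square)
          also have "\<dots> \<le> (Z b - 1)\<^sup>2 / 1" using Z by (intro divide_left_mono) auto
          finally show ?thesis by simp
        qed
        ultimately show ?case by simp
      qed
    qed
  qed
  have "(\<lambda>b. b * (M b - (b * V + b\<^sup>2 / 2 * \<kappa>)) - b * (M b * (1 - inverse (Z b) ^ 1))
      - (ln (Z b) - (Z b - 1)) - (Z b - (1 + b\<^sup>2 / 2 * V + b ^ 3 / 6 * \<kappa>)))
      \<in> O[at_right 0](\<lambda>b. b ^ 4)"
    by (intro sum_in_bigo(2) 1 2 3 Z_taylor)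
  moreover have "b * (m - (b * V + b\<^sup>2 / 2 * \<kappa>)) - b * (m * (1 - i ^ 1)) - (l - (z - 1))
      - (z - (1 + b\<^sup>2 / 2 * V + b ^ 3 / 6 * \<kappa>)) = b * (m * i) - l - (b\<^sup>2 / 2 * V + b ^ 3 / 3 * \<kappa>)"
    for b m i l z
    by (simp add: field_simps eval_nat_numeral)
  ultimately show ?thesis
    by (simp only: ent_def divide_inverse)
qed

lemma payoff_tilt:
  "payoff (tilt b) = (\<integral>y. h y * exp (b * S y) \<partial>iid T P) * inverse (Z b) ^ T"
proof -
  have "h y * (\<Prod>t\<in>{1..T}. tilt b (y t)) = h y * exp (b * S y) * inverse (Z b) ^ T" for y
    by (simp add: tilt_def S_def prod_dividef exp_sum sum_distrib_left field_simps)
  thus ?thesis by (simp only: payoff_def integral_mult_left_zero)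
qed

text \<open>The normalisation does not contribute at second order, because \<open>h\<close> is centred.\<close>

lemma payoff_tilt_taylor:
  "(\<lambda>b. payoff (tilt b) - (b * V + b\<^sup>2 / 2 * H2)) \<in> O[at_right 0](\<lambda>b. b ^ 3)"
proof -
  define I where "I = (\<lambda>b. \<integral>y. h y * exp (b * S y) \<partial>iid T P)"
  have I3: "(\<lambda>b. I b - (b * V + b\<^sup>2 / 2 * H2)) \<in> O[at_right 0](\<lambda>b. b ^ 3)"
    unfolding I_def by (rule h_exp_taylor)
  have "(\<lambda>b::real. b ^ 3) \<in> O[at_right 0](\<lambda>b. b)" using monomial_in_bigo[of 1 3 1] by simp
  from landau_o.big.trans[OF I3 this]
  have "(\<lambda>b. (I b - (b * V + b\<^sup>2 / 2 * H2)) + (b * V + b\<^sup>2 / 2 * H2)) \<in> O[at_right 0](\<lambda>b. b)"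
    using monomial_in_bigo[of 1 1 V] monomial_in_bigo[of 1 2 "H2 / 2"]
    by (intro sum_in_bigo(1)) simp_all
  hence "I \<in> O[at_right 0](\<lambda>b. b)" by simp
  from landau_o.big.mult[OF this inverse_Z_power[of T]]
  have "(\<lambda>b. I b * (1 - inverse (Z b) ^ T)) \<in> O[at_right 0](\<lambda>b. b ^ 3)"
    by (simp add: eval_nat_numeral)
  from sum_in_bigo(2)[OF I3 this] show ?thesis
    by (simp add: payoff_tilt I_def algebra_simps)
qed

end

context dominated_functional
begin

interpretation PP: product_sigma_finite "\<lambda>_::nat. P" by standard

section \<open>Comparison of a competitor with the tilted law\<close>

lemma integrable_w_mult:
  assumes [measurable]: "f \<in> borel_measurable P" and "integrable P (\<lambda>x. w x * \<bar>f x\<bar>)"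
  shows "integrable P (\<lambda>x. w x * f x)" "integrable P (\<lambda>x. g x * f x)"
  by (rule Bochner_Integration.integrable_bound[OF assms(2)];
      auto simp: abs_mult intro!: mult_right_mono g_le_w)+

text \<open>Expanding \<open>payoff\<close> around \<open>a\<close>, but with the gradient \<open>g\<close> taken at \<open>1\<close> instead of at \<open>a\<close>. The
  error is quadratic: one factor \<open>N\<close> is the distance from \<open>L\<close> to \<open>a\<close>, and the other factor \<open>D + N\<close>
  accounts for the shift of the base point from \<open>1\<close> to \<open>a\<close> as well.\<close>

lemma payoff_second_order:
  assumes [measurable]: "L \<in> borel_measurable P" "a \<in> borel_measurable P"
    and da: "integrable P (\<lambda>x. w x * \<bar>a x - 1\<bar>)" and dL: "integrable P (\<lambda>x. w x * \<bar>L x - a x\<bar>)"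
  defines "B \<equiv> \<integral>x. w x \<partial>P" and "D \<equiv> \<integral>x. w x * \<bar>a x - 1\<bar> \<partial>P" and "N \<equiv> \<integral>x. w x * \<bar>L x - a x\<bar> \<partial>P"
  shows "\<bar>payoff L - payoff a - (\<integral>x. g x * (L x - a x) \<partial>P)\<bar>
    \<le> real T * real T * (B + D + N) ^ (T - 2) * (N * (D + N))"
proof -
  define d where "d x = a x - 1" for x
  define e where "e x = L x - a x" for x
  have [measurable]: "d \<in> borel_measurable P" "e \<in> borel_measurable P"
    unfolding d_def[abs_def] e_def[abs_def] by measurable
  have a_eq: "a x = 1 + d x" and L_eq: "L x = 1 + d x + e x" for x by (simp_all add: d_def e_def)
  have iw: "integrable P w" using integrable_w_power[of 1] by simp
  have id: "integrable P (\<lambda>x. w x * \<bar>d x\<bar>)" and ie: "integrable P (\<lambda>x. w x * \<bar>e x\<bar>)"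
    using da dL by (simp_all add: d_def e_def)
  define u1 where "u1 = (\<lambda>_::nat. \<lambda>x. w x * (1 + \<bar>d x\<bar> + \<bar>e x\<bar>))"
  define u2 where "u2 = (\<lambda>_::nat. \<lambda>x. w x * (1 + \<bar>d x\<bar>))"
  define u3 where "u3 = (\<lambda>s y. (\<Prod>t\<in>{1..T}. w (y t)) * \<bar>e (y (s::nat))\<bar>)"
  have u1: "integrable P (u1 t)" and u2: "integrable P (u2 t)" for t
    using iw id ie by (simp_all add: u1_def u2_def distrib_left)
  have pu1: "(\<Prod>t\<in>{1..T}. u1 t (y t)) = (\<Prod>t\<in>{1..T}. w (y t)) * (\<Prod>t\<in>{1..T}. 1 + \<bar>d (y t)\<bar> + \<bar>e (y t)\<bar>)"
    and pu2: "(\<Prod>t\<in>{1..T}. u2 t (y t)) = (\<Prod>t\<in>{1..T}. w (y t)) * (\<Prod>t\<in>{1..T}. 1 + \<bar>d (y t)\<bar>)" for y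
    by (simp_all add: u1_def u2_def prod.distrib)
  have I1: "(\<integral>y. (\<Prod>t\<in>{1..T}. u1 t (y t)) \<partial>iid T P) = (B + D + N) ^ T"
    by (subst PP.product_integral_prod)
       (use u1 iw id ie in \<open>simp_all add: u1_def distrib_left B_def D_def N_def d_def[symmetric] e_def[symmetric]\<close>)
  have I2: "(\<integral>y. (\<Prod>t\<in>{1..T}. u2 t (y t)) \<partial>iid T P) = (B + D) ^ T"
    by (subst PP.product_integral_prod)
       (use u2 iw id in \<open>simp_all add: u2_def distrib_left B_def D_def d_def[symmetric]\<close>)
  note coord = iid_one_coordinate[OF prob_space_axioms iw ie]
  have I3: "(\<integral>y. u3 s y \<partial>iid T P) = N * B ^ (T - 1)" and J3: "integrable (iid T P) (u3 s)"
    if "s \<in> {1..T}" for s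
    using coord[OF that] by (simp_all add: u3_def N_def B_def e_def)
  have J1: "integrable (iid T P) (\<lambda>y. \<Prod>t\<in>{1..T}. u1 t (y t))"
    and J2: "integrable (iid T P) (\<lambda>y. \<Prod>t\<in>{1..T}. u2 t (y t))"
    using u1 u2 by (auto intro!: PP.product_integrable_prod)
  have abs_le: "\<bar>h y * c\<bar> \<le> (\<Prod>t\<in>{1..T}. w (y t)) * c'" if "y \<in> space (iid T P)" "\<bar>c\<bar> \<le> c'" for y c c'
    unfolding abs_mult using that h_le_w by (intro mult_mono) (auto intro!: prod_nonneg)
  have HL: "integrable (iid T P) (\<lambda>y. h y * (\<Prod>t\<in>{1..T}. L (y t)))"
  proof (rule Bochner_Integration.integrable_bound[OF J1], measurable, rule AE_I2)
    fix y assume y: "y \<in> space (iid T P)"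
    have "\<bar>\<Prod>t\<in>{1..T}. L (y t)\<bar> \<le> (\<Prod>t\<in>{1..T}. 1 + \<bar>d (y t)\<bar> + \<bar>e (y t)\<bar>)"
      unfolding L_eq abs_prod by (intro prod_mono) auto
    from abs_le[OF y this] show "norm (h y * (\<Prod>t\<in>{1..T}. L (y t))) \<le> norm (\<Prod>t\<in>{1..T}. u1 t (y t))"
      unfolding pu1 by (auto intro: order_trans[OF _ abs_ge_self] simp del: One_nat_def)
  qed
  have Ha: "integrable (iid T P) (\<lambda>y. h y * (\<Prod>t\<in>{1..T}. a (y t)))"
  proof (rule Bochner_Integration.integrable_bound[OF J2], measurable, rule AE_I2)
    fix y assume y: "y \<in> space (iid T P)"
    have "\<bar>\<Prod>t\<in>{1..T}. a (y t)\<bar> \<le> (\<Prod>t\<in>{1..T}. 1 + \<bar>d (y t)\<bar>)"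
      unfolding a_eq abs_prod by (intro prod_mono) auto
    from abs_le[OF y this] show "norm (h y * (\<Prod>t\<in>{1..T}. a (y t))) \<le> norm (\<Prod>t\<in>{1..T}. u2 t (y t))"
      unfolding pu2 by (auto intro: order_trans[OF _ abs_ge_self] simp del: One_nat_def)
  qed
  have He: "integrable (iid T P) (\<lambda>y. h y * (\<Sum>s\<in>{1..T}. e (y s)))"
  proof (rule Bochner_Integration.integrable_bound)
    show "integrable (iid T P) (\<lambda>y. \<Sum>s\<in>{1..T}. u3 s y)"
      using J3 by auto
    show "AE y in iid T P. norm (h y * (\<Sum>s\<in>{1..T}. e (y s))) \<le> norm (\<Sum>s\<in>{1..T}. u3 s y)"
    proof (rule AE_I2)
      fix y assume y: "y \<in> space (iid T P)"
      have "\<bar>h y * (\<Sum>s\<in>{1..T}. e (y s))\<bar>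
          \<le> (\<Prod>t\<in>{1..T}. w (y t)) * (\<Sum>s\<in>{1..T}. \<bar>e (y s)\<bar>)"
        by (rule abs_le[OF y sum_abs])
      also have "\<dots> = (\<Sum>s\<in>{1..T}. u3 s y)"
        by (simp add: u3_def sum_distrib_left del: One_nat_def)
      finally show "norm (h y * (\<Sum>s\<in>{1..T}. e (y s))) \<le> norm (\<Sum>s\<in>{1..T}. u3 s y)"
        by (auto intro: order_trans[OF _ abs_ge_self] simp del: One_nat_def)
    qed
  qed measurable
  have "payoff L - payoff a - (\<integral>x. g x * (L x - a x) \<partial>P)
      = (\<integral>y. h y * (\<Prod>t\<in>{1..T}. L (y t)) - h y * (\<Prod>t\<in>{1..T}. a (y t))
          - h y * (\<Sum>s\<in>{1..T}. e (y s)) \<partial>iid T P)"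
    using gradient[of e] integrable_w_mult(1)[OF _ ie] HL Ha He
    by (simp add: payoff_def e_def)
  moreover have "\<bar>\<integral>y. h y * (\<Prod>t\<in>{1..T}. L (y t)) - h y * (\<Prod>t\<in>{1..T}. a (y t))
          - h y * (\<Sum>s\<in>{1..T}. e (y s)) \<partial>iid T P\<bar>
      \<le> (\<integral>y. (\<Prod>t\<in>{1..T}. u1 t (y t)) - (\<Prod>t\<in>{1..T}. u2 t (y t))
          - (\<Sum>s\<in>{1..T}. u3 s y) \<partial>iid T P)"
  proof (rule order_trans[OF integral_abs_bound integral_mono])
    fix y assume y: "y \<in> space (iid T P)"
    have "\<bar>h y * ((\<Prod>t\<in>{1..T}. L (y t)) - (\<Prod>t\<in>{1..T}. a (y t)) - (\<Sum>s\<in>{1..T}. e (y s)))\<bar>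
        \<le> (\<Prod>t\<in>{1..T}. w (y t)) * ((\<Prod>t\<in>{1..T}. 1 + \<bar>d (y t)\<bar> + \<bar>e (y t)\<bar>)
            - (\<Prod>t\<in>{1..T}. 1 + \<bar>d (y t)\<bar>) - (\<Sum>s\<in>{1..T}. \<bar>e (y s)\<bar>))"
      unfolding L_eq a_eq by (rule abs_le[OF y prod_second_order_abs_le]) simp
    thus "\<bar>h y * (\<Prod>t\<in>{1..T}. L (y t)) - h y * (\<Prod>t\<in>{1..T}. a (y t)) - h y * (\<Sum>s\<in>{1..T}. e (y s))\<bar>
        \<le> (\<Prod>t\<in>{1..T}. u1 t (y t)) - (\<Prod>t\<in>{1..T}. u2 t (y t)) - (\<Sum>s\<in>{1..T}. u3 s y)"
      unfolding pu1 pu2 u3_def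
      by (simp add: right_diff_distrib sum_distrib_left del: One_nat_def)
  qed (intro integrable_abs Bochner_Integration.integrable_diff Bochner_Integration.integrable_sum
      HL Ha He J1 J2 J3; assumption)+
  moreover have "(\<integral>y. (\<Prod>t\<in>{1..T}. u1 t (y t)) - (\<Prod>t\<in>{1..T}. u2 t (y t))
          - (\<Sum>s\<in>{1..T}. u3 s y) \<partial>iid T P)
      = (B + D + N) ^ T - (B + D) ^ T - real T * N * B ^ (T - 1)"
  proof -
    have Js: "integrable (iid T P) (\<lambda>y. \<Sum>s\<in>{1..T}. u3 s y)"
      by (intro Bochner_Integration.integrable_sum J3)
    have "(\<integral>y. (\<Sum>s\<in>{1..T}. u3 s y) \<partial>iid T P) = (\<Sum>s\<in>{1..T}. \<integral>y. u3 s y \<partial>iid T P)"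
      by (intro Bochner_Integration.integral_sum J3)
    hence "(\<integral>y. (\<Sum>s\<in>{1..T}. u3 s y) \<partial>iid T P) = real T * N * B ^ (T - 1)"
      using I3 by simp
    thus ?thesis
      unfolding Bochner_Integration.integral_diff[OF Bochner_Integration.integrable_diff[OF J1 J2] Js]
        Bochner_Integration.integral_diff[OF J1 J2] I1 I2 by simp
  qed
  moreover have "(B + D + N) ^ T - (B + D) ^ T - real T * N * B ^ (T - 1)
      \<le> real T * real T * (B + D + N) ^ (T - 2) * (N * (D + N))"
    by (rule power_second_diff_le) (simp_all add: B_def D_def N_def)
  ultimately show ?thesis by linarith
qed

lemma integrable_w_mult_of_entropy:
  assumes [measurable]: "L \<in> borel_measurable P" and L0: "\<And>x. 0 \<le> L x"
    and L: "integrable P L" and LL: "integrable P (\<lambda>x. L x * ln (L x))"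
  shows "integrable P (\<lambda>x. w x * \<bar>L x - 1\<bar>)" "integrable P (\<lambda>x. w x * \<bar>L x\<bar>)"
proof -
  show 1: "integrable P (\<lambda>x. w x * \<bar>L x - 1\<bar>)"
    by (rule weighted_pinsker(1)[where c = "\<theta> / 4" and l = "\<theta> / 4"])
       (use L LL L0 \<theta>_pos integrable_w_exp[of "\<theta> / 4" 2] in simp_all)
  have "\<bar>w x * \<bar>L x\<bar>\<bar> \<le> \<bar>w x * \<bar>L x - 1\<bar> + w x\<bar>" for x
  proof -
    have "w x * L x \<le> w x * (\<bar>L x - 1\<bar> + 1)" by (intro mult_left_mono) auto
    thus ?thesis using L0[of x] by (simp add: distrib_left)
  qed
  note le = this
  have "integrable P (\<lambda>x. w x * \<bar>L x - 1\<bar> + w x)"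
    using 1 integrable_w_power[of 1] by simp
  thus "integrable P (\<lambda>x. w x * \<bar>L x\<bar>)"
    by (rule Bochner_Integration.integrable_bound) (use le in auto)
qed

lemma
  assumes b: "0 \<le> b" "b \<le> \<theta> / 4"
  shows tilt_integrable: "integrable P (tilt b)"
    and tilt_entropy_integrable: "integrable P (\<lambda>x. tilt b x * ln (tilt b x))"
    and tilt_entropy: "(\<integral>x. tilt b x * ln (tilt b x) \<partial>P) = ent b"
proof -
  show t: "integrable P (tilt b)"
    unfolding tilt_def using exp_integrable[OF b] by simp
  have gt: "integrable P (\<lambda>x. g x * tilt b x)"
    unfolding tilt_def using exp_integrable[OF b] by simp
  have eq: "(\<lambda>x. tilt b x * ln (tilt b x)) = (\<lambda>x. b * (g x * tilt b x) - ln (Z b) * tilt b x)"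
    by (simp add: ln_tilt[OF b] algebra_simps)
  show "integrable P (\<lambda>x. tilt b x * ln (tilt b x))"
    unfolding eq using t gt by simp
  show "(\<integral>x. tilt b x * ln (tilt b x) \<partial>P) = ent b"
    unfolding eq using t gt by (simp add: ent_def integral_g_tilt tilt_mean[OF b])
qed

text \<open>\<open>G\<close> below is the first-order gain of \<open>L\<close> over the tilted law. Since \<open>ln (tilt b)\<close> is affine
  in \<open>g\<close>, the relative entropy \<open>d\<close> of \<open>L\<close> with respect to the tilted law is an affine function of
  \<open>G\<close>, so no competitor of entropy at most \<open>ent b\<close> has a positive gain, and deviating from the
  tilted law costs \<open>d / b\<close>.\<close>

lemma relative_entropy_tilt:
  assumes b: "0 \<le> b" "b \<le> \<theta> / 4"
    and [measurable]: "L \<in> borel_measurable P" and L0: "\<And>x. 0 \<le> L x"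
    and L: "integrable P L" "(\<integral>x. L x \<partial>P) = 1" and LL: "integrable P (\<lambda>x. L x * ln (L x))"
  defines "d \<equiv> \<integral>x. L x * ln (L x) - L x * ln (tilt b x) - L x + tilt b x \<partial>P"
    and "G \<equiv> \<integral>x. g x * (L x - tilt b x) \<partial>P"
    and "A \<equiv> \<integral>x. (w x)\<^sup>2 * exp (\<theta> / 2 * w x) \<partial>P"
    and "N \<equiv> \<integral>x. w x * \<bar>L x - tilt b x\<bar> \<partial>P"
  shows "integrable P (\<lambda>x. w x * \<bar>L x - tilt b x\<bar>)"
    and "0 \<le> d"
    and "d = (\<integral>x. L x * ln (L x) \<partial>P) - ent b - b * G"
    and "\<bar>G\<bar> \<le> N"
    and "0 < l \<Longrightarrow> l \<le> \<theta> / 4 \<Longrightarrow> N \<le> d / l + l * A"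
proof -
  note t = tilt_integrable[OF b]
  have gt: "integrable P (\<lambda>x. g x * tilt b x)"
    unfolding tilt_def using exp_integrable[OF b] by simp
  have gL: "integrable P (\<lambda>x. g x * L x)"
    using integrable_w_mult(2)[OF _ integrable_w_mult_of_entropy(2)[OF _ L0 L(1) LL]] by simp
  have eq: "(\<lambda>x. L x * ln (L x) - L x * ln (tilt b x) - L x + tilt b x)
      = (\<lambda>x. L x * ln (L x) - (b * (g x * L x) - ln (Z b) * L x) - L x + tilt b x)"
    by (simp add: ln_tilt[OF b] algebra_simps)
  have int_ent: "integrable P (\<lambda>x. L x * ln (L x) - L x * ln (tilt b x) - L x + tilt b x)"
    unfolding eq using t gL L LL by simp
  have d_eq: "d = (\<integral>x. L x * ln (L x) \<partial>P) - (b * (\<integral>x. g x * L x \<partial>P) - ln (Z b)) - 1 + 1"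
    unfolding d_def eq using t gL L LL by (simp add: tilt_mean[OF b])
  have G_eq: "G = (\<integral>x. g x * L x \<partial>P) - M b / Z b"
    unfolding G_def right_diff_distrib using gL gt by (simp add: integral_g_tilt)
  show "d = (\<integral>x. L x * ln (L x) \<partial>P) - ent b - b * G"
    unfolding d_eq G_eq by (simp add: ent_def right_diff_distrib)
  show "0 \<le> d"
    unfolding d_def
  proof (rule Bochner_Integration.integral_nonneg)
    fix x
    show "0 \<le> L x * ln (L x) - L x * ln (tilt b x) - L x + tilt b x"
      using entropy_young[OF tilt_pos[OF b] L0, of 0] by simp
  qed
  have tilt_le: "tilt b x * ((w x)\<^sup>2 * exp (\<theta> / 4 * w x)) \<le> (w x)\<^sup>2 * exp (\<theta> / 2 * w x)" for x
  proof -
    have "b * g x \<le> \<theta> / 4 * w x"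
    proof -
      have "b * g x \<le> b * w x" using g_le_w[of x] b by (intro mult_left_mono) auto
      also have "\<dots> \<le> \<theta> / 4 * w x" using b by (intro mult_right_mono) auto
      finally show ?thesis .
    qed
    hence "tilt b x \<le> exp (\<theta> / 4 * w x) / 1"
      unfolding tilt_def using Z_ge_1[OF b] by (intro frac_le) auto
    hence "tilt b x * ((w x)\<^sup>2 * exp (\<theta> / 4 * w x)) \<le> exp (\<theta> / 4 * w x) * ((w x)\<^sup>2 * exp (\<theta> / 4 * w x))"
      by (intro mult_right_mono) auto
    also have "\<dots> = (w x)\<^sup>2 * exp (\<theta> / 2 * w x)"
      by (simp add: mult.left_commute flip: exp_add)
    finally show ?thesis .
  qed
  have w2: "integrable P (\<lambda>x. (w x)\<^sup>2 * exp (\<theta> / 2 * w x))"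
    using integrable_w_exp[of "\<theta> / 2" 2] by simp
  have int_A: "integrable P (\<lambda>x. tilt b x * ((w x)\<^sup>2 * exp (\<theta> / 4 * w x)))"
    by (rule Bochner_Integration.integrable_bound[OF w2])
       (use tilt_le tilt_pos[OF b] in \<open>auto simp: abs_mult less_imp_le\<close>)
  note pinsker = weighted_pinsker[OF _ _ _ L0 tilt_pos[OF b] w_nonneg int_ent int_A]
  show int_N: "integrable P (\<lambda>x. w x * \<bar>L x - tilt b x\<bar>)"
    using \<theta>_pos by (intro pinsker(1)[where l = "\<theta> / 4"]) simp_all
  show "N \<le> d / l + l * A" if l: "0 < l" "l \<le> \<theta> / 4"
  proof -
    have "N \<le> d / l + l * (\<integral>x. tilt b x * ((w x)\<^sup>2 * exp (\<theta> / 4 * w x)) \<partial>P)"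
      unfolding N_def d_def using l by (intro pinsker(2)) auto
    also have "(\<integral>x. tilt b x * ((w x)\<^sup>2 * exp (\<theta> / 4 * w x)) \<partial>P) \<le> A"
      unfolding A_def by (intro integral_mono int_A w2 tilt_le)
    finally show ?thesis using l by (simp add: mult_left_mono)
  qed
  have "\<bar>G\<bar> \<le> (\<integral>x. \<bar>g x * (L x - tilt b x)\<bar> \<partial>P)"
    unfolding G_def by (rule integral_abs_bound)
  also have "\<dots> \<le> N"
    unfolding N_def using integrable_w_mult(2)[OF _ int_N]
    by (intro integral_mono integrable_abs int_N) (auto simp: abs_mult intro!: mult_right_mono g_le_w)
  finally show "\<bar>G\<bar> \<le> N" .
qed

text \<open>The Pinsker inequality at \<open>l = b\<close>, as the entropy of the tilted law is of order \<open>b\<^sup>2\<close>.\<close>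

lemma tilt_distance:
  "(\<lambda>b. \<integral>x. w x * \<bar>tilt b x - 1\<bar> \<partial>P) \<in> O[at_right 0](\<lambda>b. b)"
proof -
  have "(\<lambda>b::real. b ^ 4) \<in> O[at_right 0](\<lambda>b. b\<^sup>2)" using monomial_in_bigo[of 2 4 1] by simp
  from landau_o.big.trans[OF ent_taylor this]
  have "(\<lambda>b. (ent b - (b\<^sup>2 / 2 * V + b ^ 3 / 3 * \<kappa>)) + (b\<^sup>2 / 2 * V + b ^ 3 / 3 * \<kappa>))
      \<in> O[at_right 0](\<lambda>b. b\<^sup>2)"
    using monomial_in_bigo[of 2 2 "V / 2"] monomial_in_bigo[of 2 3 "\<kappa> / 3"]
    by (intro sum_in_bigo(1)) simp_all
  hence "ent \<in> O[at_right 0](\<lambda>b. b\<^sup>2)" by simp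
  then obtain C where C: "\<forall>\<^sub>F b in at_right 0. norm (ent b) \<le> C * norm (b\<^sup>2)"
    by (elim landau_o.bigE)
  define A where "A = (\<integral>x. 1 * ((w x)\<^sup>2 * exp (\<theta> / 4 * w x)) \<partial>P)"
  show ?thesis
  proof (rule bigoI[where c = "C + A"])
    show "\<forall>\<^sub>F b in at_right 0. norm (\<integral>x. w x * \<bar>tilt b x - 1\<bar> \<partial>P) \<le> (C + A) * norm b"
      using C eventually_range
    proof eventually_elim
      case (elim b)
      hence b: "0 \<le> b" "b \<le> \<theta> / 4" and b0: "0 < b" by auto
      note i = tilt_integrable[OF b] tilt_entropy_integrable[OF b]
      have "(\<integral>x. w x * \<bar>tilt b x - 1\<bar> \<partial>P)
          \<le> (\<integral>x. tilt b x * ln (tilt b x) - tilt b x * ln 1 - tilt b x + 1 \<partial>P) / b + b * A"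
        unfolding A_def
        by (rule weighted_pinsker(2))
           (use b b0 i tilt_pos[OF b] integrable_w_exp[of "\<theta> / 4" 2] in \<open>simp_all add: less_imp_le\<close>)
      also have "(\<integral>x. tilt b x * ln (tilt b x) - tilt b x * ln 1 - tilt b x + 1 \<partial>P) = ent b"
        using i by (simp add: tilt_entropy[OF b] tilt_mean[OF b] prob_space)
      also have "ent b / b \<le> C * b"
        using elim b0 by (simp add: field_simps power2_eq_square)
      finally show ?case
        using b0 by (simp add: algebra_simps)
    qed
  qed
qed

text \<open>With \<open>d\<close> the entropy of \<open>L\<close> relative to the tilted law, the first-order gain is at most
  \<open>- d / b\<close>, whereas by the Pinsker inequality the remaining terms are at most of order
  \<open>d + b * sqrt d\<close>. The former dominates up to \<open>b\<^sup>3\<close>. In the proof, \<open>s\<close> plays the role of \<open>sqrt d\<close>;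
  the term \<open>b\<^sup>2\<close> keeps it positive.\<close>

lemma payoff_le_payoff_tilt:
  "\<exists>C. \<forall>\<^sub>F b in at_right 0. \<forall>L. L \<in> borel_measurable P \<longrightarrow> (\<forall>x. 0 \<le> L x) \<longrightarrow> integrable P L \<longrightarrow>
      (\<integral>x. L x \<partial>P) = 1 \<longrightarrow> integrable P (\<lambda>x. L x * ln (L x)) \<longrightarrow>
      (\<integral>x. L x * ln (L x) \<partial>P) \<le> ent b \<longrightarrow> payoff L \<le> payoff (tilt b) + C * b ^ 3"
proof -
  obtain C0 where C0: "\<forall>\<^sub>F b in at_right 0. norm (\<integral>x. w x * \<bar>tilt b x - 1\<bar> \<partial>P) \<le> C0 * norm b"
    and C0_pos: "0 < C0"
    using tilt_distance by (elim landau_o.bigE) blast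
  define A where "A = (\<integral>x. (w x)\<^sup>2 * exp (\<theta> / 2 * w x) \<partial>P)"
  define B where "B = (\<integral>x. w x \<partial>P)"
  define r where "r = \<theta> / 4"
  define R where "R = B + C0 + (1 + A) * r"
  define K where "K = real T * real T * R ^ (T - 2) * ((1 + A) * (C0 + 1 + A)) + 1"
  have A: "0 \<le> A" and B: "0 \<le> B" and r: "0 < r"
    using \<theta>_pos by (simp_all add: A_def B_def r_def)
  have K: "0 < K" and R: "0 \<le> R"
    using A B r C0_pos by (auto simp: K_def R_def intro!: add_nonneg_pos)
  have small: "\<forall>\<^sub>F b in at_right 0. b \<le> c" if "0 < c" for c :: real
    using eventually_at_right_real[OF that] by eventually_elim auto
  have pos: "\<forall>\<^sub>F b::real in at_right 0. 0 < b"
    using eventually_at_right_less by auto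
  have c1: "0 < r / (8 * A + 1)" and c2: "0 < 1 / (4 * K)"
    using A r K by auto
  have "\<forall>\<^sub>F b in at_right 0. \<forall>L. L \<in> borel_measurable P \<longrightarrow> (\<forall>x. 0 \<le> L x) \<longrightarrow> integrable P L \<longrightarrow>
      (\<integral>x. L x \<partial>P) = 1 \<longrightarrow> integrable P (\<lambda>x. L x * ln (L x)) \<longrightarrow>
      (\<integral>x. L x * ln (L x) \<partial>P) \<le> ent b \<longrightarrow> payoff L \<le> payoff (tilt b) + (1 + K\<^sup>2) * b ^ 3"
    using C0 pos small[OF zero_less_one] small[OF half_gt_zero[OF r]] small[OF c1] small[OF c2]
  proof eventually_elim
    case (elim b)
    hence b0: "0 < b" and b1: "b \<le> 1" and b2: "b \<le> r / 2" and b3: "b * (8 * A + 1) \<le> r"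
      and b4: "b * (4 * K) \<le> 1" and D: "(\<integral>x. w x * \<bar>tilt b x - 1\<bar> \<partial>P) \<le> C0 * b"
      using A K by (auto simp: pos_le_divide_eq)
    have b: "0 \<le> b" "b \<le> \<theta> / 4" using b0 b2 r by (auto simp: r_def)
    show ?case
    proof (intro allI impI)
      fix L assume [measurable]: "L \<in> borel_measurable P" and L0: "\<forall>x. 0 \<le> L x"
        and L: "integrable P L" "(\<integral>x. L x \<partial>P) = 1" and LL: "integrable P (\<lambda>x. L x * ln (L x))"
        and le: "(\<integral>x. L x * ln (L x) \<partial>P) \<le> ent b"
      define d where "d = (\<integral>x. L x * ln (L x) - L x * ln (tilt b x) - L x + tilt b x \<partial>P)"
      define G where "G = (\<integral>x. g x * (L x - tilt b x) \<partial>P)"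
      define N where "N = (\<integral>x. w x * \<bar>L x - tilt b x\<bar> \<partial>P)"
      define D where "D = (\<integral>x. w x * \<bar>tilt b x - 1\<bar> \<partial>P)"
      note re = relative_entropy_tilt[OF b _ L0[rule_format] L LL, folded d_def G_def A_def N_def r_def]
      have d0: "0 \<le> d" and dG: "d \<le> - b * G" and GN: "\<bar>G\<bar> \<le> N" using re(2-4) le by auto
      have Nl: "N \<le> d / l + l * A" if "0 < l" "l \<le> r" for l using re(5) that by auto
      have d_le: "d \<le> 2 * b * r * A"
      proof -
        have "d \<le> b * (- G)" using dG by simp
        also have "\<dots> \<le> b * N" using GN b0 by (intro mult_left_mono) auto
        also have "\<dots> \<le> b * (d / r + r * A)" using Nl[of r] r b0 by (intro mult_left_mono) auto
        also have "b * (d / r) \<le> d / 2"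
          using mult_right_mono[OF b2 d0] r by (simp add: field_simps)
        hence "b * (d / r + r * A) \<le> d / 2 + b * r * A" by (simp add: distrib_left)
        finally show ?thesis by simp
      qed
      define s where "s = sqrt d + b\<^sup>2"
      have s0: "0 < s" using d0 b0 by (simp add: s_def add_nonneg_pos)
      have "d \<le> (r / 2)\<^sup>2"
      proof -
        have "r * (b * (8 * A)) \<le> r * (b * (8 * A + 1))" using r b0 by (intro mult_left_mono) auto
        also have "\<dots> \<le> r * r" using b3 r by (intro mult_left_mono) auto
        finally show ?thesis using d_le by (simp add: power2_eq_square field_simps)
      qed
      hence "sqrt d \<le> r / 2" using r by (intro real_le_lsqrt) auto
      moreover have "b\<^sup>2 \<le> r / 2"
        using mult_mono[OF b1 b2] b0 r by (simp add: power2_eq_square)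
      ultimately have sr: "s \<le> r" by (simp add: s_def)
      have ds: "d \<le> s\<^sup>2"
      proof -
        have "(sqrt d)\<^sup>2 \<le> s\<^sup>2" using d0 by (intro power_mono) (auto simp: s_def)
        thus ?thesis using d0 by simp
      qed
      have sd: "s\<^sup>2 \<le> 2 * d + 2 * b ^ 4"
      proof -
        have "s\<^sup>2 \<le> 2 * (sqrt d)\<^sup>2 + 2 * (b\<^sup>2)\<^sup>2"
          using zero_le_power2[of "sqrt d - b\<^sup>2"] unfolding s_def power2_sum power2_diff by linarith
        thus ?thesis using d0 by simp
      qed
      have N0: "0 \<le> N" and D0: "0 \<le> D" by (simp_all add: N_def D_def)
      have Ns: "N \<le> (1 + A) * s"
      proof -
        have "d / s \<le> s" using ds s0 by (simp add: divide_le_eq power2_eq_square)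
        thus ?thesis using Nl[OF s0 sr] by (simp add: algebra_simps)
      qed
      have D1: "D \<le> C0 * b" using D by (simp add: D_def)
      have "payoff L - payoff (tilt b) - G \<le> real T * real T * (B + D + N) ^ (T - 2) * (N * (D + N))"
        using payoff_second_order[of L "tilt b"] re(1) integrable_w_mult_of_entropy(1)[OF _ _
            tilt_integrable[OF b] tilt_entropy_integrable[OF b]] tilt_pos[OF b]
        by (simp add: B_def D_def N_def G_def less_imp_le abs_le_iff)
      also have "\<dots> \<le> real T * real T * R ^ (T - 2) * (((1 + A) * s) * (C0 * b + (1 + A) * s))"
      proof (intro mult_mono power_mono order_refl)
        have "C0 * b \<le> C0 * 1" using b1 C0_pos by (intro mult_left_mono) auto
        moreover have "(1 + A) * s \<le> (1 + A) * r" using sr A by (intro mult_left_mono) auto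
        ultimately show "B + D + N \<le> R" using D1 Ns by (simp add: R_def)
      qed (use Ns D1 N0 D0 A B s0 C0_pos b0 R in \<open>auto intro!: add_nonneg_nonneg add_mono\<close>)
      also have "((1 + A) * s) * (C0 * b + (1 + A) * s) \<le> ((1 + A) * (C0 + 1 + A)) * (b * s + s\<^sup>2)"
      proof -
        have "C0 * b * s + (1 + A) * s\<^sup>2 \<le> (C0 + 1 + A) * (b * s) + (C0 + 1 + A) * s\<^sup>2"
          using A C0_pos b0 s0 by (intro add_mono) (auto simp: mult.assoc intro!: mult_right_mono)
        from mult_left_mono[OF this, of "1 + A"] A show ?thesis
          by (simp add: algebra_simps power2_eq_square)
      qed
      hence "real T * real T * R ^ (T - 2) * (((1 + A) * s) * (C0 * b + (1 + A) * s))
          \<le> real T * real T * R ^ (T - 2) * (((1 + A) * (C0 + 1 + A)) * (b * s + s\<^sup>2))"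
        using R by (intro mult_left_mono) auto
      also have "\<dots> \<le> K * (b * s + s\<^sup>2)"
        unfolding K_def using b0 s0 by (simp add: algebra_simps)
      finally have gain: "payoff L - payoff (tilt b) - G \<le> K * (b * s + s\<^sup>2)" .
      \<comment> \<open>\<open>K * b * s \<le> s\<^sup>2 / (4 * b) + K\<^sup>2 * b\<^sup>3\<close> is the arithmetic-geometric mean inequality.\<close>
      have "K * (b * s + s\<^sup>2) \<le> s\<^sup>2 / (2 * b) + K\<^sup>2 * b ^ 3"
      proof -
        have "0 \<le> (s - 2 * K * b\<^sup>2)\<^sup>2" by simp
        hence "4 * K * b\<^sup>2 * s \<le> s\<^sup>2 + 4 * K\<^sup>2 * b ^ 4"
          by (simp add: power2_eq_square algebra_simps eval_nat_numeral)
        moreover have "b * (4 * K) * s\<^sup>2 \<le> 1 * s\<^sup>2" using b4 by (intro mult_right_mono) auto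
        ultimately have "4 * b * (K * (b * s + s\<^sup>2)) \<le> 2 * s\<^sup>2 + 4 * K\<^sup>2 * b ^ 4"
          by (simp add: algebra_simps power2_eq_square)
        also have "\<dots> = 4 * b * (s\<^sup>2 / (2 * b) + K\<^sup>2 * b ^ 3)"
          using b0 by (simp add: field_simps eval_nat_numeral)
        finally show ?thesis using b0 by simp
      qed
      moreover have "s\<^sup>2 / (2 * b) \<le> d / b + b ^ 3"
        using sd b0 by (simp add: field_simps eval_nat_numeral)
      moreover have "G \<le> - (d / b)" using dG b0 by (simp add: field_simps)
      ultimately show "payoff L \<le> payoff (tilt b) + (1 + K\<^sup>2) * b ^ 3"
        using gain by (simp add: distrib_right)
    qed
  qed
  thus ?thesis by blast
qed

end

section \<open>The expansion of the optimal value\<close>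

lemma density_of_ac_prob:
  assumes P: "prob_space P" and Q: "Q \<in> ac_probs P"
    and L_def: "L = (\<lambda>x. enn2real (RN_deriv P Q x))"
  shows "L \<in> borel_measurable P" "density P (\<lambda>x. ennreal (L x)) = Q"
    "integrable P L" "(\<integral>x. L x \<partial>P) = 1"
proof -
  interpret P: prob_space P by fact
  interpret Q: prob_space Q using Q by (simp add: ac_probs_def)
  have ac: "absolutely_continuous P Q" "sets Q = sets P"
    using Q by (auto simp: ac_probs_def)
  show L[measurable]: "L \<in> borel_measurable P" unfolding L_def by measurable
  obtain D where D: "AE x in P. RN_deriv P Q x = ennreal (D x)" "\<And>x. 0 \<le> D x"
    using P.real_RN_deriv[OF Q.finite_measure_axioms ac] by metis
  have "density P (\<lambda>x. ennreal (L x)) = density P (RN_deriv P Q)"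
    by (rule density_cong) (use D in \<open>auto simp: L_def\<close>)
  thus dens: "density P (\<lambda>x. ennreal (L x)) = Q"
    using P.density_RN_deriv[OF ac] by simp
  have nn: "(\<integral>\<^sup>+x. ennreal (L x) \<partial>P) = 1"
    using Q.emeasure_space_1 unfolding dens[symmetric] by (simp add: emeasure_density cong: nn_integral_cong)
  show int: "integrable P L"
    by (rule integrableI_nonneg) (auto simp: nn, simp add: L_def)
  show "(\<integral>x. L x \<partial>P) = 1"
    by (subst integral_eq_nn_integral) (auto simp: nn, simp add: L_def)
qed

lemma density_in_ac_probs:
  fixes L :: "'b \<Rightarrow> real"
  assumes P: "prob_space P" and [measurable]: "L \<in> borel_measurable P" and L0: "\<And>x. 0 \<le> L x"
    and L: "integrable P L" "(\<integral>x. L x \<partial>P) = 1" and LL: "integrable P (\<lambda>x. L x * ln (L x))"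
  shows "density P (\<lambda>x. ennreal (L x)) \<in> ac_probs P"
    and "kl_div (density P (\<lambda>x. ennreal (L x))) P = ereal (\<integral>x. L x * ln (L x) \<partial>P)"
proof -
  interpret P: prob_space P by fact
  have "(\<integral>\<^sup>+x. ennreal (L x) \<partial>P) = 1"
    using L L0 by (subst nn_integral_eq_integral) auto
  hence "prob_space (density P (\<lambda>x. ennreal (L x)))"
    by (intro prob_spaceI) (simp add: emeasure_density cong: nn_integral_cong)
  thus "density P (\<lambda>x. ennreal (L x)) \<in> ac_probs P"
    by (auto simp: ac_probs_def intro!: absolutely_continuousI_density)
  have "AE x in P. ennreal (L x) = RN_deriv P (density P (\<lambda>x. ennreal (L x))) x"
    by (rule P.RN_deriv_unique) auto
  hence ae: "AE x in P. enn2real (RN_deriv P (density P (\<lambda>x. ennreal (L x))) x) = L x"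
    by eventually_elim (metis L0 enn2real_ennreal)
  let ?R = "\<lambda>x. enn2real (RN_deriv P (density P (\<lambda>x. ennreal (L x))) x)"
  have ae': "AE x in P. ?R x * ln (?R x) = L x * ln (L x)"
    using ae by eventually_elim simp
  have "integrable P (\<lambda>x. ?R x * ln (?R x)) \<longleftrightarrow> integrable P (\<lambda>x. L x * ln (L x))"
    by (rule integrable_cong_AE[OF _ _ ae']) measurable
  moreover have "(\<integral>x. ?R x * ln (?R x) \<partial>P) = (\<integral>x. L x * ln (L x) \<partial>P)"
    by (rule integral_cong_AE[OF _ _ ae']) measurable
  ultimately show "kl_div (density P (\<lambda>x. ennreal (L x))) P = ereal (\<integral>x. L x * ln (L x) \<partial>P)"
    using LL by (simp add: kl_div_def Let_def)
qed

context dominated_functional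
begin

interpretation PP: product_sigma_finite "\<lambda>_::nat. P" by standard

lemma expectation_eq_payoff:
  assumes [measurable]: "L \<in> borel_measurable P" and L0: "\<And>x. 0 \<le> L x"
    and L: "integrable P L" "(\<integral>x. L x \<partial>P) = 1" and LL: "integrable P (\<lambda>x. L x * ln (L x))"
  shows "(\<integral>y. h y + c \<partial>iid T (density P (\<lambda>x. ennreal (L x)))) = payoff L + c"
proof -
  have Q: "prob_space (density P (\<lambda>x. ennreal (L x)))"
    using density_in_ac_probs(1)[OF prob_space_axioms _ L0 L LL] by (simp add: ac_probs_def)
  interpret QT: prob_space "iid T (density P (\<lambda>x. ennreal (L x)))"
    using Q by (intro prob_space_PiM)
  have wL: "integrable P (\<lambda>x. w x * \<bar>L x\<bar>)"
    using integrable_w_mult_of_entropy(2)[OF _ L0 L(1) LL] by simp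
  have prod0: "0 \<le> (\<Prod>t\<in>{1..T}. L (y t))" for y by (intro prod_nonneg) (simp add: L0)
  have int: "integrable (iid T P) (\<lambda>y. (\<Prod>t\<in>{1..T}. L (y t)) * h y)"
  proof (rule integrable_iid[where v = "\<lambda>_ x. w x * \<bar>L x\<bar>" and C = 1])
    fix y assume "y \<in> space (iid T P)"
    from mult_left_mono[OF h_le_w[OF this] prod0[of y]]
    show "\<bar>(\<Prod>t\<in>{1..T}. L (y t)) * h y\<bar> \<le> 1 * (\<Prod>t\<in>{1..T}. w (y t) * \<bar>L (y t)\<bar>)"
      using prod0[of y] by (simp add: abs_mult prod.distrib L0 mult.commute)
  qed (measurable, simp add: wL)
  note dens = iid_density[OF prob_space_axioms _ L0 Q, of T]
  have "integrable (iid T (density P (\<lambda>x. ennreal (L x)))) h"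
    using int prod0 by (simp add: dens integrable_density del: One_nat_def)
  hence "(\<integral>y. h y + c \<partial>iid T (density P (\<lambda>x. ennreal (L x))))
      = (\<integral>y. h y \<partial>iid T (density P (\<lambda>x. ennreal (L x)))) + (\<integral>y. c \<partial>iid T (density P (\<lambda>x. ennreal (L x))))"
    by (rule Bochner_Integration.integral_add) (rule QT.integrable_const)
  also have "(\<integral>y. c \<partial>iid T (density P (\<lambda>x. ennreal (L x)))) = c"
    using QT.prob_space by simp
  also have "(\<integral>y. h y \<partial>iid T (density P (\<lambda>x. ennreal (L x)))) = payoff L"
    using prod0 by (simp add: dens integral_density payoff_def mult.commute del: One_nat_def)
  finally show ?thesis .
qed

lemma payoff_tilt_le_opt_value:
  assumes b: "0 \<le> b" "b \<le> \<theta> / 4"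
  shows "ereal (payoff (tilt b) + c) \<le> opt_value P T (\<lambda>y. h y + c) (ent b)"
proof -
  note t0 = less_imp_le[OF tilt_pos[OF b]]
  note t = tilt_meas t0 tilt_integrable[OF b] tilt_mean[OF b] tilt_entropy_integrable[OF b]
  have "density P (\<lambda>x. ennreal (tilt b x)) \<in> {Q \<in> ac_probs P. kl_div Q P \<le> ereal (ent b)}"
    using density_in_ac_probs[OF prob_space_axioms t] by (simp add: tilt_entropy[OF b])
  thus ?thesis
    unfolding opt_value_def expectation_eq_payoff[OF t, symmetric] by (rule SUP_upper)
qed

lemma opt_value_le:
  assumes le: "\<And>L. L \<in> borel_measurable P \<Longrightarrow> (\<And>x. 0 \<le> L x) \<Longrightarrow> integrable P L \<Longrightarrow>
      (\<integral>x. L x \<partial>P) = 1 \<Longrightarrow> integrable P (\<lambda>x. L x * ln (L x)) \<Longrightarrow>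
      (\<integral>x. L x * ln (L x) \<partial>P) \<le> \<eta> \<Longrightarrow> payoff L \<le> u"
  shows "opt_value P T (\<lambda>y. h y + c) \<eta> \<le> ereal (u + c)"
  unfolding opt_value_def
proof (rule SUP_least)
  fix Q assume "Q \<in> {Q \<in> ac_probs P. kl_div Q P \<le> ereal \<eta>}"
  hence Q: "Q \<in> ac_probs P" and kl: "kl_div Q P \<le> ereal \<eta>" by auto
  define L where "L = (\<lambda>x. enn2real (RN_deriv P Q x))"
  note L = density_of_ac_prob[OF prob_space_axioms Q L_def]
  have L0: "\<And>x. 0 \<le> L x" by (simp add: L_def)
  have LL: "integrable P (\<lambda>x. L x * ln (L x))" "(\<integral>x. L x * ln (L x) \<partial>P) \<le> \<eta>"
    using kl by (auto simp: kl_div_def Let_def L_def split: if_splits)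
  have "(\<integral>y. h y + c \<partial>iid T Q) = payoff L + c"
    using expectation_eq_payoff[OF L(1) L0 L(3,4) LL(1), of c] unfolding L(2) .
  thus "ereal (\<integral>y. h y + c \<partial>iid T Q) \<le> ereal (u + c)"
    using le[OF L(1) L0 L(3,4) LL] by simp
qed

lemma ent_quadratic: "(\<lambda>b. ent b - b\<^sup>2 / 2 * V) \<in> O[at_right 0](\<lambda>b. b ^ 3)"
proof -
  have "(\<lambda>b::real. b ^ 4) \<in> O[at_right 0](\<lambda>b. b ^ 3)" using monomial_in_bigo[of 3 4 1] by simp
  from landau_o.big.trans[OF ent_taylor this]
  have "(\<lambda>b. (ent b - (b\<^sup>2 / 2 * V + b ^ 3 / 3 * \<kappa>)) + b ^ 3 / 3 * \<kappa>) \<in> O[at_right 0](\<lambda>b. b ^ 3)"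
    using monomial_in_bigo[of 3 3 "\<kappa> / 3"] by (intro sum_in_bigo(1)) simp_all
  thus ?thesis by simp
qed

lemma eventually_ent_lower: "\<forall>\<^sub>F b in at_right 0. b\<^sup>2 / 4 * V \<le> ent b"
proof -
  obtain C where C: "0 < C" "\<forall>\<^sub>F b in at_right 0. norm (ent b - b\<^sup>2 / 2 * V) \<le> C * norm (b ^ 3)"
    using ent_quadratic by (elim landau_o.bigE)
  have "0 < V / (4 * C)" using C V_pos by simp
  from eventually_at_right_real[OF this] C(2) show ?thesis
  proof eventually_elim
    case (elim b)
    hence "C * b \<le> V / 4" "0 < b" using C(1) by (auto simp: field_simps)
    hence "b\<^sup>2 * (C * b) \<le> b\<^sup>2 * (V / 4)" by (intro mult_left_mono) auto
    hence "C * b ^ 3 \<le> b\<^sup>2 / 4 * V" by (simp add: eval_nat_numeral algebra_simps)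
    moreover have "b\<^sup>2 / 2 * V - ent b \<le> C * b ^ 3"
      using elim(2) \<open>0 < b\<close> by (simp add: abs_le_iff)
    ultimately show ?case by linarith
  qed
qed

text \<open>By the intermediate value theorem every small radius is the entropy of a tilted law, so a
  property of all small \<open>b\<close> becomes a property of all small radii.\<close>

lemma eventually_ent:
  assumes Q: "\<forall>\<^sub>F b in at_right 0. Q b"
  shows "\<forall>\<^sub>F \<eta> in at_right 0. \<exists>b. ent b = \<eta> \<and> 0 < b \<and> Q b"
proof -
  have "\<forall>\<^sub>F b in at_right 0. Q b \<and> b\<^sup>2 / 4 * V \<le> ent b \<and> b \<le> \<theta> / 4"
    using Q eventually_ent_lower eventually_range by eventually_elim auto
  then obtain e where e: "0 < e" "\<And>b. 0 < b \<Longrightarrow> b < e \<Longrightarrow> Q b \<and> b\<^sup>2 / 4 * V \<le> ent b \<and> b \<le> \<theta> / 4"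
    by (auto simp: eventually_at_right_field)
  define c where "c = e / 2"
  have c: "0 < c" "c < e" using e(1) by (auto simp: c_def)
  have "0 < c\<^sup>2 / 4 * V" using c V_pos by simp
  hence "0 < ent c" using e(2)[OF c] by linarith
  from eventually_at_right_real[OF this] show ?thesis
  proof eventually_elim
    case (elim \<eta>)
    have "continuous_on {0..c} ent"
      using continuous_on_ent e(2)[OF c] by (auto elim: continuous_on_subset)
    then obtain b where b: "0 \<le> b" "b \<le> c" "ent b = \<eta>"
      using IVT'[of ent 0 \<eta> c] elim c by (auto simp: ent_0)
    moreover have "b \<noteq> 0" using b(3) elim ent_0 by auto
    ultimately show ?case using e(2)[of b] c by (intro exI[of _ b]) auto
  qed
qed

text \<open>Eliminating the parameter: with \<open>\<eta> = ent b\<close>, \<open>sqrt (2 * V * \<eta>)\<close> is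
  \<open>b * V + b\<^sup>2 / 3 * \<kappa>\<close> up to \<open>b\<^sup>3\<close>, and this cubic correction of the entropy is what turns the
  coefficient \<open>H2 / 2\<close> of \<open>b\<^sup>2\<close> into \<open>H2 / 2 - \<kappa> / 3\<close>.\<close>

lemma payoff_tilt_in_terms_of_ent:
  "(\<lambda>b. payoff (tilt b) - (sqrt (2 * V * ent b) + 1 / V * (1 / 3 * \<kappa> + (H2 - \<kappa>)) * ent b))
    \<in> O[at_right 0](\<lambda>b. b ^ 3)"
proof -
  have pos: "\<forall>\<^sub>F b::real in at_right 0. 0 < b"
    using eventually_at_right_less by auto
  define y where "y b = b * V + b\<^sup>2 / 3 * \<kappa>" for b
  have sq: "(\<lambda>b. 2 * V * ent b - (y b)\<^sup>2) \<in> O[at_right 0](\<lambda>b. b ^ 4)"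
  proof -
    have "(\<lambda>b. 2 * V * (ent b - (b\<^sup>2 / 2 * V + b ^ 3 / 3 * \<kappa>)) - b ^ 4 * (\<kappa>\<^sup>2 / 9))
        \<in> O[at_right 0](\<lambda>b. b ^ 4)"
      using V_pos ent_taylor by (intro sum_in_bigo(2) monomial_in_bigo) simp_all
    moreover have "2 * V * (e - (b\<^sup>2 / 2 * V + b ^ 3 / 3 * \<kappa>)) - b ^ 4 * (\<kappa>\<^sup>2 / 9) = 2 * V * e - (y b)\<^sup>2"
      for b e by (simp add: y_def field_simps eval_nat_numeral)
    ultimately show ?thesis by (simp only:)
  qed
  then obtain C where C: "0 < C" "\<forall>\<^sub>F b in at_right 0. norm (2 * V * ent b - (y b)\<^sup>2) \<le> C * norm (b ^ 4)"
    by (elim landau_o.bigE)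
  have y_lower: "\<forall>\<^sub>F b in at_right 0. b * V / 2 \<le> y b"
  proof -
    have "0 < V / (\<bar>\<kappa>\<bar> + 1)" using V_pos by simp
    from eventually_at_right_real[OF this] show ?thesis
    proof eventually_elim
      case (elim b)
      hence b: "0 < b" "b * (\<bar>\<kappa>\<bar> + 1) < V" by (auto simp: field_simps)
      have "- (b * \<kappa>) \<le> b * (\<bar>\<kappa>\<bar> + 1)"
        using b mult_left_mono[of "- \<kappa>" "\<bar>\<kappa>\<bar> + 1" b] by simp
      hence "b * (- (b * \<kappa>)) \<le> b * V" using b by (intro mult_left_mono) auto
      moreover have "0 \<le> b * V" using b V_pos by simp
      ultimately show ?case unfolding y_def by (simp add: power2_eq_square algebra_simps)
    qed
  qed
  have sqrt3: "(\<lambda>b. sqrt (2 * V * ent b) - y b) \<in> O[at_right 0](\<lambda>b. b ^ 3)"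
  proof (rule bigoI[where c = "2 * C / V"])
    show "\<forall>\<^sub>F b in at_right 0. norm (sqrt (2 * V * ent b) - y b) \<le> 2 * C / V * norm (b ^ 3)"
      using C(2) y_lower pos eventually_ent_lower
    proof eventually_elim
      case (elim b)
      have V: "0 < V" by (rule V_pos)
      have "0 \<le> b\<^sup>2 / 4 * V" using V by simp
      hence ent0: "0 \<le> ent b" using elim by linarith
      define x where "x = sqrt (2 * V * ent b)"
      have x0: "0 \<le> x" and xx: "x\<^sup>2 = 2 * V * ent b" using ent0 V by (auto simp: x_def)
      have "b * V / 2 * \<bar>x - y b\<bar> \<le> (x + y b) * \<bar>x - y b\<bar>"
        using elim x0 by (intro mult_right_mono) auto
      also have "\<dots> = \<bar>x\<^sup>2 - (y b)\<^sup>2\<bar>"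
      proof -
        have "0 \<le> b * V / 2" using elim V by simp
        hence "0 \<le> x + y b" using elim x0 by linarith
        hence "(x + y b) * \<bar>x - y b\<bar> = \<bar>(x + y b) * (x - y b)\<bar>" by (simp add: abs_mult)
        thus ?thesis by (simp add: power2_eq_square algebra_simps)
      qed
      also have "\<dots> \<le> C * b ^ 4" using elim xx by simp
      finally show ?case
        using elim V by (simp add: x_def field_simps eval_nat_numeral)
    qed
  qed
  define c where "c = 1 / V * (1 / 3 * \<kappa> + (H2 - \<kappa>))"
  have "(\<lambda>b. (payoff (tilt b) - (b * V + b\<^sup>2 / 2 * H2)) - (sqrt (2 * V * ent b) - y b)
      - c * (ent b - b\<^sup>2 / 2 * V)) \<in> O[at_right 0](\<lambda>b. b ^ 3)"
    using ent_quadratic by (intro sum_in_bigo(2) payoff_tilt_taylor sqrt3) simp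
  moreover have "(p - (b * V + b\<^sup>2 / 2 * H2)) - (q - y b) - c * (e - b\<^sup>2 / 2 * V) = p - (q + c * e)"
    for b p q e
    using V_pos by (simp add: y_def c_def field_simps)
  ultimately show ?thesis unfolding c_def by (simp only:)
qed

lemma opt_value_expansion:
  fixes c :: real
  defines "r \<equiv> \<lambda>\<eta>. real_of_ereal (opt_value P T (\<lambda>y. h y + c) \<eta>)
      - (c + sqrt (2 * V) * \<eta> powr (1 / 2) + 1 / V * (1 / 3 * \<kappa> + (H2 - \<kappa>)) * \<eta>)"
  shows "\<forall>\<^sub>F \<eta> in at_right 0. \<bar>opt_value P T (\<lambda>y. h y + c) \<eta>\<bar> \<noteq> \<infinity>"
    and "r \<in> O[at_right 0](\<lambda>\<eta>. \<eta> powr (3 / 2))"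
proof -
  obtain C1 where C1: "\<forall>\<^sub>F b in at_right 0. \<forall>L. L \<in> borel_measurable P \<longrightarrow> (\<forall>x. 0 \<le> L x) \<longrightarrow>
      integrable P L \<longrightarrow> (\<integral>x. L x \<partial>P) = 1 \<longrightarrow> integrable P (\<lambda>x. L x * ln (L x)) \<longrightarrow>
      (\<integral>x. L x * ln (L x) \<partial>P) \<le> ent b \<longrightarrow> payoff L \<le> payoff (tilt b) + C1 * b ^ 3"
    using payoff_le_payoff_tilt by blast
  define p where "p \<eta> = sqrt (2 * V * \<eta>) + 1 / V * (1 / 3 * \<kappa> + (H2 - \<kappa>)) * \<eta>" for \<eta>
  obtain C2 where C2: "\<forall>\<^sub>F b in at_right 0. norm (payoff (tilt b) - p (ent b)) \<le> C2 * norm (b ^ 3)"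
    using payoff_tilt_in_terms_of_ent unfolding p_def by (elim landau_o.bigE)
  have "\<forall>\<^sub>F b in at_right 0. (b\<^sup>2 / 4 * V \<le> ent b \<and> \<bar>payoff (tilt b) - p (ent b)\<bar> \<le> C2 * \<bar>b ^ 3\<bar>) \<and>
      ereal (payoff (tilt b) + c) \<le> opt_value P T (\<lambda>y. h y + c) (ent b) \<and>
      opt_value P T (\<lambda>y. h y + c) (ent b) \<le> ereal (payoff (tilt b) + C1 * b ^ 3 + c)"
    using C1 C2 eventually_ent_lower eventually_range
  proof eventually_elim
    case (elim b)
    moreover have "opt_value P T (\<lambda>y. h y + c) (ent b) \<le> ereal (payoff (tilt b) + C1 * b ^ 3 + c)"
      using elim by (intro opt_value_le) blast
    ultimately show ?case using payoff_tilt_le_opt_value[of b c] by auto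
  qed
  note ev = eventually_ent[OF this]
  from ev show "\<forall>\<^sub>F \<eta> in at_right 0. \<bar>opt_value P T (\<lambda>y. h y + c) \<eta>\<bar> \<noteq> \<infinity>"
  proof eventually_elim
    case (elim \<eta>)
    thus ?case by (cases "opt_value P T (\<lambda>y. h y + c) \<eta>") auto
  qed
  show "r \<in> O[at_right 0](\<lambda>\<eta>. \<eta> powr (3 / 2))"
  proof (rule bigoI[where c = "(\<bar>C1\<bar> + \<bar>C2\<bar>) * (4 / V) powr (3 / 2)"])
    show "\<forall>\<^sub>F \<eta> in at_right 0. norm (r \<eta>) \<le> (\<bar>C1\<bar> + \<bar>C2\<bar>) * (4 / V) powr (3 / 2) * norm (\<eta> powr (3 / 2))"
      using ev
    proof eventually_elim
      case (elim \<eta>)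
      then obtain b where b: "ent b = \<eta>" "0 < b" "b\<^sup>2 / 4 * V \<le> \<eta>" and C2: "\<bar>payoff (tilt b) - p \<eta>\<bar> \<le> C2 * b ^ 3"
        and lo: "ereal (payoff (tilt b) + c) \<le> opt_value P T (\<lambda>y. h y + c) \<eta>"
        and hi: "opt_value P T (\<lambda>y. h y + c) \<eta> \<le> ereal (payoff (tilt b) + C1 * b ^ 3 + c)"
        by auto
      obtain v where v: "opt_value P T (\<lambda>y. h y + c) \<eta> = ereal v"
        using lo hi by (cases "opt_value P T (\<lambda>y. h y + c) \<eta>") auto
      have "0 < b\<^sup>2 / 4 * V" using V_pos b(2) by simp
      hence \<eta>: "0 < \<eta>" using b(3) by linarith
      have "r \<eta> = (v - c - payoff (tilt b)) + (payoff (tilt b) - p \<eta>)"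
        using \<eta> by (simp add: r_def v p_def powr_half_sqrt real_sqrt_mult)
      moreover have "C1 * b ^ 3 \<le> \<bar>C1\<bar> * b ^ 3" using b(2) by (intro mult_right_mono) auto
      hence "0 \<le> v - c - payoff (tilt b)" "v - c - payoff (tilt b) \<le> \<bar>C1\<bar> * b ^ 3"
        using lo hi by (auto simp: v)
      moreover have "C2 * b ^ 3 \<le> \<bar>C2\<bar> * b ^ 3" using b(2) by (intro mult_right_mono) auto
      ultimately have "\<bar>r \<eta>\<bar> \<le> (\<bar>C1\<bar> + \<bar>C2\<bar>) * b ^ 3"
        using C2 by (simp add: distrib_right abs_le_iff)
      also have "b ^ 3 = b powr 3" using b(2) by (simp add: powr_numeral)
      also have "b powr 3 = (b\<^sup>2) powr (3 / 2)"
        using b(2) by (simp add: powr_powr flip: powr_numeral)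
      also have "\<dots> \<le> (4 / V * \<eta>) powr (3 / 2)"
        using b(3) V_pos by (intro powr_mono2) (auto simp: field_simps)
      also have "\<dots> = (4 / V) powr (3 / 2) * \<eta> powr (3 / 2)"
        using V_pos \<eta> by (intro powr_mult)
      finally show ?case by (simp add: mult_left_mono mult.assoc)
    qed
  qed
qed

end

section \<open>Conditional expectations given one or two coordinates\<close>

text \<open>The defining property of a conditional expectation, transported to the law of \<open>Z\<close> and extended
  to unbounded test functions.\<close>

lemma is_cond_exp_given_integral:
  fixes f :: "'b \<Rightarrow> real" and \<psi> \<phi> :: "'c \<Rightarrow> real"
  assumes M: "prob_space M" and Z[measurable]: "Z \<in> measurable M N" and d: "distr M N Z = N"
    and ce: "is_cond_exp_given M Z N f \<phi>"
    and f[measurable]: "f \<in> borel_measurable M" and \<psi>[measurable]: "\<psi> \<in> borel_measurable N"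
    and int: "integrable M (\<lambda>\<omega>. f \<omega> * \<psi> (Z \<omega>))"
  shows "integrable N (\<lambda>z. \<phi> z * \<psi> z)"
    and "(\<integral>z. \<phi> z * \<psi> z \<partial>N) = (\<integral>\<omega>. f \<omega> * \<psi> (Z \<omega>) \<partial>M)"
proof -
  interpret M: prob_space M by fact
  define F where "F = vimage_algebra (space M) Z N"
  have [measurable]: "\<phi> \<in> borel_measurable N" using ce by (simp add: is_cond_exp_given_def)
  have Zs: "Z \<in> space M \<rightarrow> space N" using Z by (rule measurable_space[THEN funcsetI])
  have sub: "subalgebra M F"
    unfolding subalgebra_def F_def sets_vimage_algebra2[OF Zs]
    using Z by (auto intro: measurable_sets)
  interpret F: finite_measure_subalgebra M F
    by unfold_locales (rule sub)
  have ZF: "Z \<in> measurable F N"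
    unfolding F_def by (rule measurable_vimage_algebra1[OF Zs])
  have \<psi>F: "(\<lambda>\<omega>. \<psi> (Z \<omega>)) \<in> borel_measurable F"
    using measurable_compose[OF ZF \<psi>] .
  note ce_int = F.real_cond_exp_intg[OF _ \<psi>F f]
  have ae: "AE \<omega> in M. \<psi> (Z \<omega>) * real_cond_exp M F f \<omega> = \<phi> (Z \<omega>) * \<psi> (Z \<omega>)"
    using ce by (auto simp: is_cond_exp_given_def F_def mult.commute elim: eventually_mono)
  have [measurable]: "real_cond_exp M F f \<in> borel_measurable M"
    by (rule measurable_from_subalg[OF sub]) simp
  have i: "integrable M (\<lambda>\<omega>. \<psi> (Z \<omega>) * f \<omega>)" using int by (simp add: mult.commute)
  have "integrable M (\<lambda>\<omega>. \<phi> (Z \<omega>) * \<psi> (Z \<omega>))"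
    using ce_int(1)[OF i] integrable_cong_AE[OF _ _ ae] by simp
  hence "integrable (distr M N Z) (\<lambda>z. \<phi> z * \<psi> z)"
    by (subst integrable_distr_eq) auto
  thus "integrable N (\<lambda>z. \<phi> z * \<psi> z)" by (simp add: d)
  have "(\<integral>z. \<phi> z * \<psi> z \<partial>N) = (\<integral>z. \<phi> z * \<psi> z \<partial>distr M N Z)" by (simp add: d)
  also have "\<dots> = (\<integral>\<omega>. \<phi> (Z \<omega>) * \<psi> (Z \<omega>) \<partial>M)" by (rule integral_distr) auto
  also have "\<dots> = (\<integral>\<omega>. \<psi> (Z \<omega>) * real_cond_exp M F f \<omega> \<partial>M)"
    by (rule integral_cong_AE[symmetric, OF _ _ ae]) auto
  also have "\<dots> = (\<integral>\<omega>. f \<omega> * \<psi> (Z \<omega>) \<partial>M)"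
    using ce_int(2)[OF i] by (simp add: mult.commute)
  finally show "(\<integral>z. \<phi> z * \<psi> z \<partial>N) = (\<integral>\<omega>. f \<omega> * \<psi> (Z \<omega>) \<partial>M)" .
qed

lemma distr_iid_coordinate:
  "prob_space P \<Longrightarrow> t \<in> {1..T} \<Longrightarrow> distr (iid T P) P (\<lambda>y. y t) = P"
  by (rule distr_PiM_component)

lemma distr_iid_pair:
  assumes P: "prob_space P" and t: "t \<in> {1..T}" and s: "s \<in> {1..T}" and ts: "s \<noteq> t"
  shows "distr (iid T P) (P \<Otimes>\<^sub>M P) (\<lambda>y. (y t, y s)) = P \<Otimes>\<^sub>M P"
proof -
  interpret P: prob_space P by fact
  interpret PP: product_prob_space "\<lambda>_::nat. P" "{1..T}" by standard
  have m: "(\<lambda>y. (y t, y s)) \<in> measurable (iid T P) (P \<Otimes>\<^sub>M P)"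
    using t s by measurable
  show ?thesis
  proof (rule pair_measure_eqI[symmetric])
    show "sigma_finite_measure P" "sigma_finite_measure P" by unfold_locales
    fix A B assume A: "A \<in> sets P" and B: "B \<in> sets P"
    have "emeasure (distr (iid T P) (P \<Otimes>\<^sub>M P) (\<lambda>y. (y t, y s))) (A \<times> B)
        = emeasure (iid T P) {y \<in> space (iid T P). \<forall>i\<in>{t, s}. y i \<in> (if i = t then A else B)}"
      using A B ts by (subst emeasure_distr[OF m]) (auto intro!: arg_cong[where f = "emeasure _"])
    also have "\<dots> = (\<Prod>i\<in>{t, s}. emeasure P (if i = t then A else B))"
      using t s A B by (intro PP.emeasure_PiM_Collect) auto
    also have "\<dots> = emeasure P A * emeasure P B" using ts by auto
    finally show "emeasure P A * emeasure P B
        = emeasure (distr (iid T P) (P \<Otimes>\<^sub>M P) (\<lambda>y. (y t, y s))) (A \<times> B)" ..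
  qed simp
qed

lemma iid_h_coordinate:
  fixes h :: "(nat \<Rightarrow> 'b) \<Rightarrow> real" and w \<phi> :: "'b \<Rightarrow> real"
  assumes P: "prob_space P" and [measurable]: "h \<in> borel_measurable (iid T P)" "\<phi> \<in> borel_measurable P"
    and w: "integrable P w" and w\<phi>: "integrable P (\<lambda>x. w x * \<bar>\<phi> x\<bar>)"
    and h_le: "\<And>y. y \<in> space (iid T P) \<Longrightarrow> \<bar>h y\<bar> \<le> (\<Prod>t\<in>{1..T}. w (y t))"
    and s: "s \<in> {1..T}"
  shows "integrable (iid T P) (\<lambda>y. h y * \<phi> (y s))"
    and "\<bar>\<integral>y. h y * \<phi> (y s) \<partial>iid T P\<bar> \<le> (\<integral>x. w x * \<bar>\<phi> x\<bar> \<partial>P) * (\<integral>x. w x \<partial>P) ^ (T - 1)"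
proof -
  note c = iid_one_coordinate[OF P w w\<phi> s]
  have le: "\<bar>h y * \<phi> (y s)\<bar> \<le> (\<Prod>t\<in>{1..T}. w (y t)) * \<bar>\<phi> (y s)\<bar>" if "y \<in> space (iid T P)" for y
    unfolding abs_mult using h_le[OF that] by (intro mult_right_mono) auto
  have [measurable]: "(\<lambda>y. \<phi> (y s)) \<in> borel_measurable (iid T P)"
    using s by measurable
  show i: "integrable (iid T P) (\<lambda>y. h y * \<phi> (y s))"
  proof (rule Bochner_Integration.integrable_bound[OF c(1)], measurable, rule AE_I2)
    fix y assume "y \<in> space (iid T P)"
    from le[OF this] show "norm (h y * \<phi> (y s)) \<le> norm ((\<Prod>t\<in>{1..T}. w (y t)) * \<bar>\<phi> (y s)\<bar>)"
      by (auto intro: order_trans[OF _ abs_ge_self] simp del: One_nat_def)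
  qed
  have "\<bar>\<integral>y. h y * \<phi> (y s) \<partial>iid T P\<bar> \<le> (\<integral>y. \<bar>h y * \<phi> (y s)\<bar> \<partial>iid T P)"
    by (rule integral_abs_bound)
  also have "\<dots> \<le> (\<integral>y. (\<Prod>t\<in>{1..T}. w (y t)) * \<bar>\<phi> (y s)\<bar> \<partial>iid T P)"
    by (rule integral_mono[OF integrable_abs[OF i] c(1) le])
  finally show "\<bar>\<integral>y. h y * \<phi> (y s) \<partial>iid T P\<bar> \<le> (\<integral>x. w x * \<bar>\<phi> x\<bar> \<partial>P) * (\<integral>x. w x \<partial>P) ^ (T - 1)"
    unfolding c(2) .
qed

text \<open>A conditional expectation given one coordinate inherits a weight bound: test it against the
  signed indicator of the set where the bound fails.\<close>

lemma cond_exp_coordinate_bound: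
  fixes h :: "(nat \<Rightarrow> 'b) \<Rightarrow> real" and w m :: "'b \<Rightarrow> real"
  assumes P: "prob_space P" and h: "h \<in> borel_measurable (iid T P)"
    and w: "integrable P w" and w0: "\<And>x. 0 \<le> w x"
    and h_le: "\<And>y. y \<in> space (iid T P) \<Longrightarrow> \<bar>h y\<bar> \<le> (\<Prod>t\<in>{1..T}. w (y t))"
    and t: "t \<in> {1..T}" and ce: "is_cond_exp_given (iid T P) (\<lambda>y. y t) P h m"
  shows "AE x in P. \<bar>m x\<bar> \<le> (\<integral>x. w x \<partial>P) ^ (T - 1) * w x"
proof -
  interpret P: prob_space P by fact
  have [measurable]: "w \<in> borel_measurable P" using w by auto
  have m[measurable]: "m \<in> borel_measurable P" using ce by (simp add: is_cond_exp_given_def)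
  have PT: "prob_space (iid T P)" using P by (intro prob_space_PiM)
  define c where "c = (\<integral>x. w x \<partial>P) ^ (T - 1)"
  define I where "I x = (if c * w x < \<bar>m x\<bar> then 1 else 0 :: real)" for x
  define \<phi> where "\<phi> x = I x * sgn (m x)" for x
  have [measurable]: "I \<in> borel_measurable P" "\<phi> \<in> borel_measurable P"
    unfolding I_def[abs_def] \<phi>_def[abs_def] by measurable
  have \<phi>_le: "w x * \<bar>\<phi> x\<bar> \<le> w x * I x" "w x * I x \<le> w x" "0 \<le> I x" for x
    using w0[of x] by (auto simp: \<phi>_def I_def sgn_if)
  have wI: "integrable P (\<lambda>x. w x * I x)"
    by (rule Bochner_Integration.integrable_bound[OF w]) (use \<phi>_le w0 in \<open>auto simp: abs_mult\<close>)
  have w\<phi>: "integrable P (\<lambda>x. w x * \<bar>\<phi> x\<bar>)"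
    by (rule Bochner_Integration.integrable_bound[OF wI]) (use \<phi>_le w0 in \<open>auto simp: abs_mult\<close>)
  note hc = iid_h_coordinate[OF P h _ w w\<phi> h_le t]
  have "(\<lambda>y. y t) \<in> measurable (iid T P) P" using t by measurable
  note ci = is_cond_exp_given_integral[OF PT this distr_iid_coordinate[OF P t] ce h _ hc(1)]
  have m\<phi>: "m x * \<phi> x = I x * \<bar>m x\<bar>" for x by (simp add: \<phi>_def abs_sgn mult.left_commute)
  have mI: "integrable P (\<lambda>x. I x * \<bar>m x\<bar>)" using ci(1) by (simp add: m\<phi>)
  have "(\<integral>x. I x * \<bar>m x\<bar> \<partial>P) \<le> (\<integral>x. w x * \<bar>\<phi> x\<bar> \<partial>P) * c"
    using ci(2) hc(2) unfolding m\<phi> c_def by auto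
  also have "\<dots> \<le> (\<integral>x. w x * I x \<partial>P) * c"
    using w\<phi> wI \<phi>_le w0 by (intro mult_right_mono integral_mono) (auto simp: c_def)
  finally have "(\<integral>x. I x * \<bar>m x\<bar> - c * (w x * I x) \<partial>P) \<le> 0"
    using mI wI by (simp add: mult.commute)
  moreover have nn: "0 \<le> I x * \<bar>m x\<bar> - c * (w x * I x)" for x
    by (simp add: I_def)
  ultimately have "(\<integral>x. I x * \<bar>m x\<bar> - c * (w x * I x) \<partial>P) = 0"
    by (intro antisym Bochner_Integration.integral_nonneg) auto
  hence "AE x in P. I x * \<bar>m x\<bar> - c * (w x * I x) = 0"
    using mI wI nn by (subst (asm) integral_nonneg_eq_0_iff_AE) auto
  thus ?thesis
    unfolding c_def[symmetric]
    by eventually_elim (auto simp: I_def not_less split: if_splits)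
qed

lemma integrable_exp_sum_abs:
  fixes \<Lambda> :: "'i \<Rightarrow> 'b \<Rightarrow> real"
  assumes I: "finite I" "I \<noteq> {}"
    and exp: "\<And>t. t \<in> I \<Longrightarrow> \<exists>\<epsilon>>0. \<forall>\<theta>. \<bar>\<theta>\<bar> < \<epsilon> \<longrightarrow> integrable M (\<lambda>x. exp (\<theta> * \<Lambda> t x))"
  shows "\<And>t. t \<in> I \<Longrightarrow> \<Lambda> t \<in> borel_measurable M"
    and "\<exists>\<theta>>0. integrable M (\<lambda>x. exp (\<theta> * (1 + (\<Sum>t\<in>I. \<bar>\<Lambda> t x\<bar>))))"
proof -
  obtain e where e: "\<And>t. t \<in> I \<Longrightarrow> 0 < e t"
      "\<And>t \<theta>. t \<in> I \<Longrightarrow> \<bar>\<theta>\<bar> < e t \<Longrightarrow> integrable M (\<lambda>x. exp (\<theta> * \<Lambda> t x))"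
    using exp by metis
  show meas: "\<Lambda> t \<in> borel_measurable M" if t: "t \<in> I" for t
  proof -
    have "integrable M (\<lambda>x. exp (e t / 2 * \<Lambda> t x))" using e(1)[OF t] by (intro e(2)[OF t]) auto
    hence "(\<lambda>x. exp (e t / 2 * \<Lambda> t x)) \<in> borel_measurable M" by (rule borel_measurable_integrable)
    hence "(\<lambda>x. 2 / e t * ln (exp (e t / 2 * \<Lambda> t x))) \<in> borel_measurable M" by measurable
    thus ?thesis using e(1)[OF t] by simp
  qed
  define n where "n = real (card I)"
  have n: "0 < n" using I by (simp add: n_def card_gt_0_iff)
  define \<delta> where "\<delta> = Min (e ` I) / 2"
  have \<delta>: "0 < \<delta>" "\<And>t. t \<in> I \<Longrightarrow> \<delta> < e t"
  proof -
    have m: "0 < Min (e ` I)" using I e(1) by (subst Min_gr_iff) auto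
    thus "0 < \<delta>" by (simp add: \<delta>_def)
    fix t assume "t \<in> I"
    hence "Min (e ` I) \<le> e t" using I by (intro Min_le) auto
    thus "\<delta> < e t" using m by (simp add: \<delta>_def)
  qed
  define U where "U x = exp (\<delta> / n) * (\<Sum>t\<in>I. exp (\<delta> * \<Lambda> t x) + exp (- \<delta> * \<Lambda> t x))" for x
  have U: "integrable M U"
    unfolding U_def[abs_def] using \<delta>
    by (intro integrable_mult_right Bochner_Integration.integrable_sum Bochner_Integration.integrable_add e(2)) auto
  have [measurable]: "(\<lambda>x. \<Sum>t\<in>I. \<bar>\<Lambda> t x\<bar>) \<in> borel_measurable M"
    using meas by (intro borel_measurable_sum borel_measurable_abs) auto
  have le: "exp (\<delta> / n * (1 + (\<Sum>t\<in>I. \<bar>\<Lambda> t x\<bar>))) \<le> U x" for x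
  proof -
    \<comment> \<open>The sum is at most \<open>n\<close> times its largest term.\<close>
    obtain s where s: "s \<in> I" "\<And>t. t \<in> I \<Longrightarrow> \<bar>\<Lambda> t x\<bar> \<le> \<bar>\<Lambda> s x\<bar>"
    proof -
      have "Max ((\<lambda>t. \<bar>\<Lambda> t x\<bar>) ` I) \<in> (\<lambda>t. \<bar>\<Lambda> t x\<bar>) ` I" using I by (intro Max_in) auto
      then obtain s where s: "s \<in> I" "\<bar>\<Lambda> s x\<bar> = Max ((\<lambda>t. \<bar>\<Lambda> t x\<bar>) ` I)" by auto
      show thesis by (rule that[OF s(1)]) (use I in \<open>auto simp: s(2) intro!: Max_ge\<close>)
    qed
    have "(\<Sum>t\<in>I. \<bar>\<Lambda> t x\<bar>) \<le> n * \<bar>\<Lambda> s x\<bar>"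
      unfolding n_def using s(2) by (rule sum_bounded_above)
    hence "\<delta> / n * (\<Sum>t\<in>I. \<bar>\<Lambda> t x\<bar>) \<le> \<delta> / n * (n * \<bar>\<Lambda> s x\<bar>)"
      using \<delta> n by (intro mult_left_mono) auto
    hence "exp (\<delta> / n * (1 + (\<Sum>t\<in>I. \<bar>\<Lambda> t x\<bar>))) \<le> exp (\<delta> / n + \<delta> * \<bar>\<Lambda> s x\<bar>)"
      using n by (simp add: distrib_left)
    also have "\<dots> \<le> exp (\<delta> / n) * (exp (\<delta> * \<Lambda> s x) + exp (- \<delta> * \<Lambda> s x))"
      by (auto simp: exp_add abs_if)
    also have "\<dots> \<le> U x"
      unfolding U_def using I(1) s(1)
      by (intro mult_left_mono member_le_sum[where f = "\<lambda>t. exp (\<delta> * \<Lambda> t x) + exp (- \<delta> * \<Lambda> t x)"]) auto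
    finally show ?thesis .
  qed
  have "integrable M (\<lambda>x. exp (\<delta> / n * (1 + (\<Sum>t\<in>I. \<bar>\<Lambda> t x\<bar>))))"
    by (rule Bochner_Integration.integrable_bound[OF U])
       (use le in \<open>auto intro: order_trans[OF _ abs_ge_self]\<close>)
  thus "\<exists>\<theta>>0. integrable M (\<lambda>x. exp (\<theta> * (1 + (\<Sum>t\<in>I. \<bar>\<Lambda> t x\<bar>))))"
    using \<delta>(1) n by (intro exI[of _ "\<delta> / n"]) auto
qed

section \<open>The expansion for conditional expectations\<close>

theorem theorem3p2:
  fixes P0 :: "'a measure" and T :: nat and h :: "(nat \<Rightarrow> 'a) \<Rightarrow> real"
    and \<Lambda> :: "nat \<Rightarrow> 'a \<Rightarrow> real"
    and m1 :: "nat \<Rightarrow> 'a \<Rightarrow> real" and m2 :: "nat \<Rightarrow> nat \<Rightarrow> 'a \<times> 'a \<Rightarrow> real"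
    and g :: "'a \<Rightarrow> real" and G :: "'a \<times> 'a \<Rightarrow> real"
  assumes "prob_space P0"
    and "T > 1"
    and "h \<in> borel_measurable (iid T P0)"
    and "\<And>x. x \<in> space (iid T P0) \<Longrightarrow> \<bar>h x\<bar> \<le> (\<Sum>t\<in>{1..T}. \<Lambda> t (x t))"
    and "\<And>t. t \<in> {1..T} \<Longrightarrow>
           \<exists>\<epsilon>>0. \<forall>\<theta>. \<bar>\<theta>\<bar> < \<epsilon> \<longrightarrow> integrable P0 (\<lambda>x. exp (\<theta> * \<Lambda> t x))"
    and "\<And>t. t \<in> {1..T} \<Longrightarrow> is_cond_exp_given (iid T P0) (\<lambda>x. x t) P0 h (m1 t)"
    and "g = (\<lambda>x. \<Sum>t\<in>{1..T}. m1 t x)"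
    and "\<not> (\<exists>c. AE x in P0. g x = c)"
    and "\<And>t s. t \<in> {1..T} \<Longrightarrow> s \<in> {1..T} \<Longrightarrow> s \<noteq> t \<Longrightarrow>
           is_cond_exp_given (iid T P0) (\<lambda>x. (x t, x s)) (P0 \<Otimes>\<^sub>M P0) h (m2 t s)"
    and "G = (\<lambda>z. \<Sum>t\<in>{1..T}. \<Sum>s\<in>{1..T} - {t}. m2 t s z)"
  shows "(\<forall>\<^sub>F \<eta> in at_right 0. \<bar>opt_value P0 T h \<eta>\<bar> \<noteq> \<infinity>) \<and>
    (\<lambda>\<eta>. real_of_ereal (opt_value P0 T h \<eta>)
          - ((\<integral>x. h x \<partial>iid T P0)
             + sqrt (2 * prob_space.variance P0 g) * \<eta> powr (1/2)
             + 1 / prob_space.variance P0 g * (1/3 * cumulant3 P0 g + nu P0 g G) * \<eta>))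
      \<in> O[at_right 0](\<lambda>\<eta>. \<eta> powr (3/2))"
proof -
  note P = assms(1) and h_meas[measurable] = assms(3) and h_\<Lambda> = assms(4) and exp_\<Lambda> = assms(5)
    and ce1 = assms(6) and g_def = assms(7) and g_nonconst = assms(8) and ce2 = assms(9) and G_def = assms(10)
  interpret P0: prob_space P0 by (rule P)
  interpret PP: pair_sigma_finite P0 P0 by unfold_locales
  have PT: "prob_space (iid T P0)" using P by (intro prob_space_PiM)
  interpret PT: prob_space "iid T P0" by (rule PT)
  have T1: "{1..T} \<noteq> {}" "0 < T" using assms(2) by auto
  have m1[measurable]: "m1 t \<in> borel_measurable P0" if "t \<in> {1..T}" for t
    using ce1[OF that] by (simp add: is_cond_exp_given_def)
  have g_meas[measurable]: "g \<in> borel_measurable P0"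
    unfolding g_def by (intro borel_measurable_sum m1)

  \<comment> \<open>Summing the envelopes of all coordinates gives one weight \<open>w\<close> for which the bound on \<open>h\<close>
    by a sum turns into a bound by a product.\<close>
  define w where "w x = 1 + (\<Sum>t\<in>{1..T}. \<bar>\<Lambda> t x\<bar>)" for x
  obtain \<theta> where \<theta>: "0 < \<theta>" and exp_w: "integrable P0 (\<lambda>x. exp (\<theta> * w x))"
    using integrable_exp_sum_abs(2)[where \<Lambda> = \<Lambda>, OF finite_atLeastAtMost T1(1)] exp_\<Lambda> unfolding w_def by blast
  have [measurable]: "w \<in> borel_measurable P0"
    unfolding w_def[abs_def]
    by (intro borel_measurable_add borel_measurable_sum borel_measurable_abs borel_measurable_const
        integrable_exp_sum_abs(1)[where \<Lambda> = \<Lambda>, OF finite_atLeastAtMost T1(1)] exp_\<Lambda>)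
  have w_ge_1: "1 \<le> w x" and w0: "0 \<le> w x" for x
    by (simp_all add: w_def sum_nonneg add_nonneg_nonneg)
  have int_w: "integrable P0 w"
    by (rule Bochner_Integration.integrable_bound[OF integrable_mult_right[OF exp_w, of "1 / \<theta>"]])
       (use power_le_exp[OF w0 \<theta>, of _ 1] w0 \<theta> in \<open>auto simp: abs_mult\<close>)
  have prod_w_ge_1: "1 \<le> (\<Prod>t\<in>{1..T}. w (y t))" for y
    by (intro prod_ge_1 w_ge_1)
  have h_le: "\<bar>h y\<bar> \<le> (\<Prod>t\<in>{1..T}. w (y t))" if y: "y \<in> space (iid T P0)" for y
  proof -
    have "\<bar>h y\<bar> \<le> (\<Sum>t\<in>{1..T}. \<Lambda> t (y t))" by (rule h_\<Lambda>[OF y])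
    also have "\<dots> \<le> (\<Sum>t\<in>{1..T}. w (y t) - 1)"
    proof (rule sum_mono)
      fix t assume t: "t \<in> {1..T}"
      have "\<Lambda> t (y t) \<le> \<bar>\<Lambda> t (y t)\<bar>" by simp
      also have "\<dots> \<le> (\<Sum>s\<in>{1..T}. \<bar>\<Lambda> s (y t)\<bar>)"
        using t by (intro member_le_sum[where f = "\<lambda>s. \<bar>\<Lambda> s (y t)\<bar>"]) auto
      finally show "\<Lambda> t (y t) \<le> w (y t) - 1" by (simp add: w_def)
    qed
    also have "\<dots> \<le> (\<Prod>t\<in>{1..T}. w (y t))"
      using prod_one_plus_ge[of "{1..T}" "\<lambda>t. w (y t) - 1"] w_ge_1 by simp
    finally show ?thesis .
  qed

  have coord: "(\<lambda>y. y t) \<in> measurable (iid T P0) P0" if "t \<in> {1..T}" for t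
    using that by measurable
  have
    h1: "integrable (iid T P0) (\<lambda>y. h y * \<phi> (y t))" (is ?A) and
    m1: "integrable P0 (\<lambda>x. m1 t x * \<phi> x)" (is ?B) and
    hm1: "(\<integral>x. m1 t x * \<phi> x \<partial>P0) = (\<integral>y. h y * \<phi> (y t) \<partial>iid T P0)" (is ?C) and
    i1: "integrable (iid T P0) (\<lambda>y. \<phi> (y t))" (is ?D) and
    e1: "(\<integral>y. \<phi> (y t) \<partial>iid T P0) = (\<integral>x. \<phi> x \<partial>P0)" (is ?E)
    if t: "t \<in> {1..T}" and \<phi>[measurable]: "\<phi> \<in> borel_measurable P0"
      and w\<phi>: "integrable P0 (\<lambda>x. w x * \<bar>\<phi> x\<bar>)" for t and \<phi> :: "'a \<Rightarrow> real"
  proof -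
    show ?A by (rule iid_h_coordinate(1)[OF P h_meas \<phi> int_w w\<phi> h_le t])
    from is_cond_exp_given_integral[OF PT coord[OF t] distr_iid_coordinate[OF P t] ce1[OF t] h_meas \<phi> this]
    show ?B ?C .
    have "integrable P0 \<phi>"
    proof (rule Bochner_Integration.integrable_bound[OF w\<phi>], measurable, rule AE_I2)
      fix x show "norm (\<phi> x) \<le> norm (w x * \<bar>\<phi> x\<bar>)"
        using mult_right_mono[OF w_ge_1[of x], of "\<bar>\<phi> x\<bar>"] w0[of x] by (simp add: abs_mult)
    qed
    hence "integrable (distr (iid T P0) P0 (\<lambda>y. y t)) \<phi>"
      by (simp only: distr_iid_coordinate[OF P t])
    thus ?D by (subst (asm) integrable_distr_eq[OF coord[OF t]]) auto
    have "(\<integral>x. \<phi> x \<partial>P0) = (\<integral>x. \<phi> x \<partial>distr (iid T P0) P0 (\<lambda>y. y t))"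
      by (simp only: distr_iid_coordinate[OF P t])
    thus ?E using integral_distr[OF coord[OF t] \<phi>] by simp
  qed
  define H where "H = (\<integral>y. h y \<partial>iid T P0)"
  have int_h: "integrable (iid T P0) h"
    using h1[of 1 "\<lambda>_. 1"] T1 int_w by simp
  define Eg where "Eg = (\<integral>x. g x \<partial>P0)"
  have Eg: "Eg = real T * H"
  proof -
    have "Eg = (\<Sum>t\<in>{1..T}. \<integral>x. m1 t x \<partial>P0)"
      unfolding Eg_def g_def using m1[of _ "\<lambda>_. 1"] int_w by (intro Bochner_Integration.integral_sum) auto
    also have "\<dots> = (\<Sum>t\<in>{1..T}. H)"
      unfolding H_def using hm1[of _ "\<lambda>_. 1"] int_w by (intro sum.cong) auto
    finally show ?thesis by simp
  qed

  \<comment> \<open>A rescaled weight dominates the centred \<open>h\<close> and, outside a null set, the centred \<open>g\<close>;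
    \<open>g'\<close> is a version of the latter that is dominated everywhere.\<close>
  define c where "c = (\<integral>x. w x \<partial>P0) ^ (T - 1)"
  define K where "K = 1 + \<bar>H\<bar> + (real T * c + \<bar>Eg\<bar>)"
  have c0: "0 \<le> c" using w0 by (simp add: c_def)
  have K1: "1 \<le> K" using c0 by (simp add: K_def)
  define g' where "g' x = (if \<bar>g x - Eg\<bar> \<le> K * w x then g x - Eg else 0)" for x
  have g'_meas[measurable]: "g' \<in> borel_measurable P0" unfolding g'_def[abs_def] by measurable
  have g': "AE x in P0. g' x = g x - Eg"
  proof -
    have "AE x in P0. \<forall>t\<in>{1..T}. \<bar>m1 t x\<bar> \<le> c * w x"
      unfolding c_def
      by (intro eventually_ball_finite ballI cond_exp_coordinate_bound[OF P h_meas int_w w0 h_le _ ce1]) auto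
    thus ?thesis
    proof eventually_elim
      case (elim x)
      have "\<bar>g x - Eg\<bar> \<le> (\<Sum>t\<in>{1..T}. \<bar>m1 t x\<bar>) + \<bar>Eg\<bar> * 1"
        unfolding g_def using sum_abs[of "\<lambda>t. m1 t x" "{1..T}"] by linarith
      also have "\<dots> \<le> (\<Sum>t\<in>{1..T}. c * w x) + \<bar>Eg\<bar> * w x"
        using elim w_ge_1 by (intro add_mono sum_mono mult_left_mono) auto
      also have "\<dots> = (real T * c + \<bar>Eg\<bar>) * w x" by (simp add: distrib_right mult.assoc)
      also have "\<dots> \<le> K * w x" using w0 by (intro mult_right_mono) (auto simp: K_def)
      finally show ?case by (simp add: g'_def)
    qed
  qed
  define h0 where "h0 y = h y - H" for y
  have h0_meas[measurable]: "h0 \<in> borel_measurable (iid T P0)"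
    unfolding h0_def[abs_def] by measurable
  have h0_le: "\<bar>h0 y\<bar> \<le> (\<Prod>t\<in>{1..T}. K * w (y t))" if y: "y \<in> space (iid T P0)" for y
  proof -
    have "\<bar>h0 y\<bar> \<le> (\<Prod>t\<in>{1..T}. w (y t)) + \<bar>H\<bar> * 1" using h_le[OF y] by (simp add: h0_def)
    also have "\<dots> \<le> (\<Prod>t\<in>{1..T}. w (y t)) + \<bar>H\<bar> * (\<Prod>t\<in>{1..T}. w (y t))"
      by (intro add_left_mono mult_left_mono prod_w_ge_1) auto
    also have "\<dots> = (1 + \<bar>H\<bar>) * (\<Prod>t\<in>{1..T}. w (y t))" by (simp add: distrib_right)
    also have "\<dots> \<le> K ^ T * (\<Prod>t\<in>{1..T}. w (y t))"
    proof (rule mult_right_mono)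
      have "1 + \<bar>H\<bar> \<le> K" using c0 by (simp add: K_def)
      also have "K \<le> K ^ T" using K1 T1 by (intro self_le_power)
      finally show "1 + \<bar>H\<bar> \<le> K ^ T" .
    qed (use prod_w_ge_1[of y] in simp)
    finally show ?thesis by (simp add: prod.distrib)
  qed
  have wK: "integrable P0 (\<lambda>x. w x * \<bar>\<phi> x\<bar>)" if "integrable P0 (\<lambda>x. K * w x * \<phi> x)" for \<phi>
  proof -
    have "integrable P0 (\<lambda>x. 1 / K * \<bar>K * w x * \<phi> x\<bar>)" using that by (intro integrable_mult_right integrable_abs)
    moreover have "1 / K * \<bar>K * w x * \<phi> x\<bar> = w x * \<bar>\<phi> x\<bar>" for x
      using K1 w0[of x] by (simp add: abs_mult)
    ultimately show ?thesis by simp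
  qed
  have gradient: "(\<integral>y. h0 y * (\<Sum>t\<in>{1..T}. \<phi> (y t)) \<partial>iid T P0) = (\<integral>x. g' x * \<phi> x \<partial>P0)"
    if \<phi>[measurable]: "\<phi> \<in> borel_measurable P0" and "integrable P0 (\<lambda>x. K * w x * \<phi> x)" for \<phi>
  proof -
    note w\<phi> = wK[OF that(2)]
    have int\<phi>: "integrable P0 \<phi>"
      using i1[of 1, OF _ \<phi> w\<phi>] T1
        integrable_distr_eq[OF coord[of 1] \<phi>] distr_iid_coordinate[OF P, of 1 T] by simp
    have "(\<integral>y. h0 y * (\<Sum>t\<in>{1..T}. \<phi> (y t)) \<partial>iid T P0)
        = (\<integral>y. (\<Sum>t\<in>{1..T}. h y * \<phi> (y t) - H * \<phi> (y t)) \<partial>iid T P0)"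
      by (simp only: h0_def left_diff_distrib sum_distrib_left sum_subtractf)
    also have "\<dots> = (\<Sum>t\<in>{1..T}. (\<integral>y. h y * \<phi> (y t) - H * \<phi> (y t) \<partial>iid T P0))"
      by (intro Bochner_Integration.integral_sum Bochner_Integration.integrable_diff integrable_mult_right
          h1[OF _ \<phi> w\<phi>] i1[OF _ \<phi> w\<phi>])
    also have "\<dots> = (\<Sum>t\<in>{1..T}. (\<integral>x. m1 t x * \<phi> x \<partial>P0) - H * (\<integral>x. \<phi> x \<partial>P0))"
    proof (rule sum.cong[OF refl])
      fix t assume t: "t \<in> {1..T}"
      show "(\<integral>y. h y * \<phi> (y t) - H * \<phi> (y t) \<partial>iid T P0) = (\<integral>x. m1 t x * \<phi> x \<partial>P0) - H * (\<integral>x. \<phi> x \<partial>P0)"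
        unfolding hm1[OF t \<phi> w\<phi>] e1[OF t \<phi> w\<phi>, symmetric]
          Bochner_Integration.integral_diff[OF h1[OF t \<phi> w\<phi>] integrable_mult_right[OF i1[OF t \<phi> w\<phi>]]]
        by simp
    qed
    also have "\<dots> = (\<Sum>t\<in>{1..T}. \<integral>x. m1 t x * \<phi> x \<partial>P0) - Eg * (\<integral>x. \<phi> x \<partial>P0)"
      by (simp add: sum_subtractf Eg)
    also have "(\<Sum>t\<in>{1..T}. \<integral>x. m1 t x * \<phi> x \<partial>P0) = (\<integral>x. g x * \<phi> x \<partial>P0)"
      unfolding g_def sum_distrib_right
      by (intro Bochner_Integration.integral_sum[symmetric] m1[OF _ \<phi> w\<phi>])
    also have "integrable P0 (\<lambda>x. g x * \<phi> x)"
      unfolding g_def sum_distrib_right by (intro Bochner_Integration.integrable_sum m1[OF _ \<phi> w\<phi>])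
    hence "(\<integral>x. g x * \<phi> x \<partial>P0) - Eg * (\<integral>x. \<phi> x \<partial>P0) = (\<integral>x. (g x - Eg) * \<phi> x \<partial>P0)"
      using int\<phi> by (simp add: left_diff_distrib)
    also have "\<dots> = (\<integral>x. g' x * \<phi> x \<partial>P0)"
      by (rule integral_cong_AE) (use g' in \<open>auto elim: eventually_mono\<close>)
    finally show ?thesis .
  qed
  have int_w2: "integrable P0 (\<lambda>x. (K * w x)\<^sup>2)"
    by (rule Bochner_Integration.integrable_bound[OF integrable_mult_right[OF exp_w, of "K\<^sup>2 * (2 / \<theta>\<^sup>2)"]])
       (use mult_left_mono[OF power_le_exp[OF w0 \<theta>, of _ 2], of "K\<^sup>2"] \<theta> in \<open>auto simp: power_mult_distrib abs_mult mult.assoc\<close>)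
  have g'_le: "\<bar>g' x\<bar> \<le> K * w x" for x
    using K1 w0[of x] by (auto simp: g'_def)
  have g'_sq_le: "(g' x)\<^sup>2 \<le> (K * w x)\<^sup>2" for x
  proof -
    have "\<bar>g' x\<bar> \<le> \<bar>K * w x\<bar>" using g'_le[of x] by linarith
    thus ?thesis by (simp only: abs_le_square_iff)
  qed
  interpret D: dominated_functional P0 T h0 "\<lambda>x. K * w x" g' "\<theta> / K"
  proof unfold_locales
    show "1 \<le> K * w x" for x using mult_mono[OF K1 w_ge_1[of x]] K1 by simp
    show "integrable P0 (\<lambda>x. exp (\<theta> / K * (K * w x)))" using exp_w K1 by simp
    show "(\<integral>y. h0 y \<partial>iid T P0) = 0"
      unfolding h0_def Bochner_Integration.integral_diff[OF int_h PT.integrable_const]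
      using PT.prob_space by (simp add: H_def)
    have int_g2: "integrable P0 (\<lambda>x. (g' x)\<^sup>2)"
      by (rule Bochner_Integration.integrable_bound[OF int_w2]) (use g'_sq_le in simp_all)
    show "0 < (\<integral>x. (g' x)\<^sup>2 \<partial>P0)"
    proof (rule ccontr)
      assume "\<not> 0 < (\<integral>x. (g' x)\<^sup>2 \<partial>P0)"
      moreover have "0 \<le> (\<integral>x. (g' x)\<^sup>2 \<partial>P0)" by (rule Bochner_Integration.integral_nonneg) simp
      ultimately have "(\<integral>x. (g' x)\<^sup>2 \<partial>P0) = 0" by simp
      hence "AE x in P0. (g' x)\<^sup>2 = 0"
        using int_g2 by (subst (asm) integral_nonneg_eq_0_iff_AE) auto
      with g' have "AE x in P0. g x = Eg" by eventually_elim auto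
      thus False using g_nonconst by blast
    qed
  qed (use T1 \<theta> K1 h0_le gradient g'_le in \<open>auto simp del: One_nat_def\<close>)

  have V: "D.V = P0.variance g"
    unfolding D.V_def Eg_def[symmetric]
    by (rule integral_cong_AE) (use g' in \<open>auto elim: eventually_mono\<close>)
  have \<kappa>: "D.\<kappa> = cumulant3 P0 g"
    unfolding D.\<kappa>_def cumulant3_def Eg_def[symmetric]
    by (rule integral_cong_AE) (use g' in \<open>auto elim: eventually_mono\<close>)

  \<comment> \<open>Expanding the square of \<open>\<Sum>\<^sub>t g' (y t)\<close>, the diagonal terms give the third cumulant, and the
    others give \<open>nu\<close>. Centring \<open>h\<close> or \<open>G\<close> does not change the latter as \<open>g'\<close> has mean zero.\<close>
  define \<psi> where "\<psi> z = g' (fst z) * g' (snd z)" for z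
  have \<psi>_meas[measurable]: "\<psi> \<in> borel_measurable (P0 \<Otimes>\<^sub>M P0)" unfolding \<psi>_def[abs_def] by measurable
  have int_g': "integrable P0 g'" using D.integrable_g_power[of 1] by simp
  have int_wg2: "integrable P0 (\<lambda>x. K * w x * (g' x)\<^sup>2)"
  proof (rule Bochner_Integration.integrable_bound[OF D.integrable_w_power[of 3]], measurable, rule AE_I2)
    fix x
    from mult_left_mono[OF g'_sq_le[of x] D.w_nonneg[of x]]
    have "K * w x * (g' x)\<^sup>2 \<le> (K * w x) ^ 3" by (simp add: power3_eq_cube power2_eq_square mult.assoc)
    moreover have "0 \<le> K * w x * (g' x)\<^sup>2" by (intro mult_nonneg_nonneg D.w_nonneg) simp
    ultimately show "norm (K * w x * (g' x)\<^sup>2) \<le> norm ((K * w x) ^ 3)" by simp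
  qed
  have i_sq: "integrable (iid T P0) (\<lambda>y. h0 y * (g' (y t))\<^sup>2)" if t: "t \<in> {1..T}" for t
  proof (rule iid_h_coordinate(1)[OF P h0_meas _ _ _ h0_le t])
    show "integrable P0 (\<lambda>x. K * w x)" using int_w by simp
    show "integrable P0 (\<lambda>x. K * w x * \<bar>(g' x)\<^sup>2\<bar>)" using int_wg2 by simp
  qed measurable
  have i_pair: "integrable (iid T P0) (\<lambda>y. h0 y * \<psi> (y t, y s))"
      and m2_int: "integrable (P0 \<Otimes>\<^sub>M P0) (\<lambda>z. m2 t s z * \<psi> z)"
      and i_pair_eq: "(\<integral>y. h0 y * \<psi> (y t, y s) \<partial>iid T P0) = (\<integral>z. m2 t s z * \<psi> z \<partial>(P0 \<Otimes>\<^sub>M P0))"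
      and \<psi>_int: "integrable (P0 \<Otimes>\<^sub>M P0) \<psi>" and \<psi>_0: "(\<integral>z. \<psi> z \<partial>(P0 \<Otimes>\<^sub>M P0)) = 0"
    if t: "t \<in> {1..T}" and s: "s \<in> {1..T}" and ts: "s \<noteq> t" for t s
  proof -
    have m: "(\<lambda>y. (y t, y s)) \<in> measurable (iid T P0) (P0 \<Otimes>\<^sub>M P0)" using t s by measurable
    have [measurable]: "(\<lambda>y. \<psi> (y t, y s)) \<in> borel_measurable (iid T P0)"
      using measurable_compose[OF m \<psi>_meas] .
    note pp = iid_pair_product[OF P int_g' D.g_mean t s ts]
    note d = distr_iid_pair[OF P t s ts]
    show i: "integrable (iid T P0) (\<lambda>y. h0 y * \<psi> (y t, y s))"
    proof (rule Bochner_Integration.integrable_bound[OF Bochner_Integration.integrable_add[OF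
          integrable_abs[OF i_sq[OF t]] integrable_abs[OF i_sq[OF s]]]])
      show "AE y in iid T P0. norm (h0 y * \<psi> (y t, y s)) \<le> norm (\<bar>h0 y * (g' (y t))\<^sup>2\<bar> + \<bar>h0 y * (g' (y s))\<^sup>2\<bar>)"
      proof (rule AE_I2)
        fix y
        have "2 * (\<bar>g' (y t)\<bar> * \<bar>g' (y s)\<bar>) \<le> (g' (y t))\<^sup>2 + (g' (y s))\<^sup>2"
          using zero_le_power2[of "\<bar>g' (y t)\<bar> - \<bar>g' (y s)\<bar>"] by (simp add: power2_diff)
        moreover have "0 \<le> \<bar>g' (y t)\<bar> * \<bar>g' (y s)\<bar>" by simp
        ultimately have "\<bar>g' (y t)\<bar> * \<bar>g' (y s)\<bar> \<le> (g' (y t))\<^sup>2 + (g' (y s))\<^sup>2" by linarith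
        from mult_left_mono[OF this, of "\<bar>h0 y\<bar>"]
        show "norm (h0 y * \<psi> (y t, y s)) \<le> norm (\<bar>h0 y * (g' (y t))\<^sup>2\<bar> + \<bar>h0 y * (g' (y s))\<^sup>2\<bar>)"
          by (simp add: \<psi>_def abs_mult distrib_left)
      qed
    qed measurable
    have "(\<lambda>y. h y * \<psi> (y t, y s)) = (\<lambda>y. h0 y * \<psi> (y t, y s) + H * (g' (y t) * g' (y s)))"
      by (simp add: h0_def \<psi>_def algebra_simps)
    hence ih: "integrable (iid T P0) (\<lambda>y. h y * \<psi> (y t, y s))"
      and eh: "(\<integral>y. h y * \<psi> (y t, y s) \<partial>iid T P0) = (\<integral>y. h0 y * \<psi> (y t, y s) \<partial>iid T P0)"
      using i pp by simp_all
    note ci = is_cond_exp_given_integral[OF PT m d ce2[OF t s ts] h_meas \<psi>_meas ih]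
    show "integrable (P0 \<Otimes>\<^sub>M P0) (\<lambda>z. m2 t s z * \<psi> z)" by (rule ci(1))
    show "(\<integral>y. h0 y * \<psi> (y t, y s) \<partial>iid T P0) = (\<integral>z. m2 t s z * \<psi> z \<partial>(P0 \<Otimes>\<^sub>M P0))"
      using ci(2) eh by simp
    have "integrable (distr (iid T P0) (P0 \<Otimes>\<^sub>M P0) (\<lambda>y. (y t, y s))) \<psi>"
      by (subst integrable_distr_eq[OF m \<psi>_meas]) (use pp(1) in \<open>simp add: \<psi>_def\<close>)
    thus "integrable (P0 \<Otimes>\<^sub>M P0) \<psi>" by (simp only: d)
    have "(\<integral>z. \<psi> z \<partial>distr (iid T P0) (P0 \<Otimes>\<^sub>M P0) (\<lambda>y. (y t, y s))) = 0"
      by (subst integral_distr[OF m \<psi>_meas]) (use pp(2) in \<open>simp add: \<psi>_def\<close>)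
    thus "(\<integral>z. \<psi> z \<partial>(P0 \<Otimes>\<^sub>M P0)) = 0" by (simp only: d)
  qed
  have G\<psi>: "integrable (P0 \<Otimes>\<^sub>M P0) (\<lambda>z. G z * \<psi> z)"
    unfolding G_def sum_distrib_right by (intro Bochner_Integration.integrable_sum m2_int) auto
  have H2: "D.H2 = D.\<kappa> + (\<integral>z. G z * \<psi> z \<partial>(P0 \<Otimes>\<^sub>M P0))"
  proof -
    have sq: "h0 y * (D.S y)\<^sup>2 = h0 y * (\<Sum>t\<in>{1..T}. (g' (y t))\<^sup>2)
        + (\<Sum>t\<in>{1..T}. \<Sum>s\<in>{1..T} - {t}. h0 y * \<psi> (y t, y s))" for y
    proof -
      have "(D.S y)\<^sup>2 = (\<Sum>t\<in>{1..T}. \<Sum>s\<in>{1..T}. g' (y t) * g' (y s))"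
        by (simp add: D.S_def power2_eq_square sum_product)
      also have "\<dots> = (\<Sum>t\<in>{1..T}. (g' (y t))\<^sup>2 + (\<Sum>s\<in>{1..T} - {t}. g' (y t) * g' (y s)))"
        by (intro sum.cong refl, subst sum.remove) (auto simp: power2_eq_square)
      finally show ?thesis by (simp add: sum.distrib distrib_left sum_distrib_left \<psi>_def)
    qed
    have diag: "integrable (iid T P0) (\<lambda>y. h0 y * (\<Sum>t\<in>{1..T}. (g' (y t))\<^sup>2))"
      unfolding sum_distrib_left by (intro Bochner_Integration.integrable_sum i_sq)
    have off: "integrable (iid T P0) (\<lambda>y. \<Sum>t\<in>{1..T}. \<Sum>s\<in>{1..T} - {t}. h0 y * \<psi> (y t, y s))"
      by (intro Bochner_Integration.integrable_sum i_pair) auto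
    from gradient[OF _ int_wg2] have "(\<integral>y. h0 y * (\<Sum>t\<in>{1..T}. (g' (y t))\<^sup>2) \<partial>iid T P0) = D.\<kappa>"
      by (simp add: D.\<kappa>_def eval_nat_numeral)
    moreover have "(\<integral>y. (\<Sum>t\<in>{1..T}. \<Sum>s\<in>{1..T} - {t}. h0 y * \<psi> (y t, y s)) \<partial>iid T P0)
        = (\<Sum>t\<in>{1..T}. \<Sum>s\<in>{1..T} - {t}. \<integral>y. h0 y * \<psi> (y t, y s) \<partial>iid T P0)"
      by (rule integral_double_sum, rule i_pair) auto
    moreover have "\<dots> = (\<Sum>t\<in>{1..T}. \<Sum>s\<in>{1..T} - {t}. \<integral>z. m2 t s z * \<psi> z \<partial>(P0 \<Otimes>\<^sub>M P0))"
      by (intro sum.cong refl i_pair_eq) auto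
    moreover have "\<dots> = (\<integral>z. G z * \<psi> z \<partial>(P0 \<Otimes>\<^sub>M P0))"
      unfolding G_def sum_distrib_right
      by (rule integral_double_sum[symmetric], rule m2_int) auto
    ultimately show ?thesis
      unfolding D.H2_def sq Bochner_Integration.integral_add[OF diag off] by simp
  qed
  have nu: "nu P0 g G = (\<integral>z. G z * \<psi> z \<partial>(P0 \<Otimes>\<^sub>M P0))"
  proof -
    have [measurable]: "G \<in> borel_measurable (P0 \<Otimes>\<^sub>M P0)"
      unfolding G_def using ce2 by (intro borel_measurable_sum) (auto simp: is_cond_exp_given_def)
    have "AE z in P0 \<Otimes>\<^sub>M P0. g' (fst z) = g (fst z) - Eg \<and> g' (snd z) = g (snd z) - Eg"
    proof (rule PP.AE_pair_measure)
      show "AE x in P0. AE y in P0. g' (fst (x, y)) = g (fst (x, y)) - Eg \<and> g' (snd (x, y)) = g (snd (x, y)) - Eg"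
        using g' by eventually_elim (use g' in \<open>auto elim: eventually_mono\<close>)
    qed measurable
    hence "nu P0 g G = (\<integral>z. (G z - (\<integral>w. G w \<partial>(P0 \<Otimes>\<^sub>M P0))) * g' (fst z) * g' (snd z) \<partial>(P0 \<Otimes>\<^sub>M P0))"
      unfolding nu_def Eg_def[symmetric] by (intro integral_cong_AE) (auto elim: eventually_mono)
    also have "\<dots> = (\<integral>z. G z * \<psi> z - (\<integral>w. G w \<partial>(P0 \<Otimes>\<^sub>M P0)) * \<psi> z \<partial>(P0 \<Otimes>\<^sub>M P0))"
      by (simp add: \<psi>_def algebra_simps)
    also have "\<dots> = (\<integral>z. G z * \<psi> z \<partial>(P0 \<Otimes>\<^sub>M P0))"
      using G\<psi> \<psi>_int[of 1 2] \<psi>_0[of 1 2] assms(2) by simp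
    finally show ?thesis .
  qed
  have "(\<lambda>y. h0 y + H) = h" by (simp add: h0_def)
  thus ?thesis
    using D.opt_value_expansion[of H] unfolding V \<kappa> H2 nu H_def by (simp add: real_sqrt_mult)
qed

end
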